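(* For all pairs of twin binary trees $J_0$ and $J_1$, we have $$\mathbf{E}_{J_0} \cdot \mathbf{E}_{J_1} = \mathbf{E}_{J_0 / J_1} \qquad\text{and}\qquad \mathbf{H}_{J_0} \cdot \mathbf{H}_{J_1} = \mathbf{H}_{J_0 \backslash J_1}.$$
   Context: $\mathbb{K}$ is a field of characteristic zero. $\mathfrak{S}$ is the set of all permutations (of all sizes $n\ge0$), seen as words; $\mathrm{std}(u)$ is the unique permutation of size $|u|$ with the same inversions as $u$. $\mathbf{FQSym}$ is the Hopf algebra over $\mathbb{K}$ with basis $\{\mathbf{F}_\sigma\}_{\sigma\in\mathfrak{S}}$, product $\mathbf{F}_\sigma\cdot\mathbf{F}_\nu = \sum_{\pi} \mathbf{F}_\pi$, where $\pi$ runs over all shuffles of $\sigma$ with the word obtained by adding $|\sigma|$ to every letter of $\nu$, and coproduct $\Delta(\mathbf{F}_\sigma) = \sum_{\sigma = uv} \mathbf{F}_{\mathrm{std}(u)} \otimes \mathbf{F}_{\mathrm{std}(v)}$. A binary tree is either a leaf (empty tree) or a node with a left and a right binary subtree. The canopy of a binary tree with $n$ nodes is the word of length $n-1$ obtained by reading its leaves from left to right except the first and the last, writing $0$ if the leaf is a right child and $1$ if it is a left child. A pair of twin binary trees is a pair of binary trees with the same number $n$ of nodes whose canopies differ at every position $1\le i\le n-1$. For a permutation $\sigma$, $\mathsf{P}(\sigma) = (T_L,T_R)$ where $T_L$ (resp. $T_R$) is the shape of the binary search tree obtained by inserting the letters of $\sigma$ from left to right (resp. right to left) with the standard binary search tree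 leaf insertion. $\mathbf{Baxter}$ is the Hopf subalgebra of $\mathbf{FQSym}$ with basis $\{\mathbf{P}_J\}$ indexed by pairs of twin binary trees, where $\mathbf{P}_J = \sum_{\sigma\in\mathfrak{S},\ \mathsf{P}(\sigma) = J} \mathbf{F}_\sigma$. The permutohedron order $\leq_{\mathrm{P}}$ on permutations of size $n$ is the partial order in which $\sigma$ is covered by $\nu$ iff $\sigma = u\,ab\,v$ and $\nu = u\,ba\,v$ for some words $u,v$ and letters $a<b$. The Baxter order on pairs of twin binary trees with $n$ nodes is defined by $J_0 \leq_{\mathrm{B}} J_1$ iff there are permutations $\sigma \leq_{\mathrm{P}} \nu$ of size $n$ with $\mathsf{P}(\sigma) = J_0$ and $\mathsf{P}(\nu) = J_1$. The elementary and homogeneous families of $\mathbf{Baxter}$ are $\mathbf{E}_J := \sum_{J \leq_{\mathrm{B}} J'} \mathbf{P}_{J'}$ and $\mathbf{H}_J := \sum_{J' \leq_{\mathrm{B}} J} \mathbf{P}_{J'}$. For binary trees $T_0,T_1$, $T_0 / T_1$ is obtained by grafting $T_0$ from its root on the leftmost leaf of $T_1$, and $T_0 \backslash T_1$ by grafting $T_1$ from its root on the rightmost leaf of $T_0$. For pairs of twin binary trees $J_0 = (T^0_L,T^0_R)$ and $J_1 = (T^1_L,T^1_R)$, $J_0 / J_1 := (T^0_L \backslash T^1_L,\ T^0_R / T^1_R)$ and $J_0 \backslash J_1 := (T^0_L / T^1_L,\ T^0_R \backslash T^1_R)$; these are pairs of twin binary trees. *)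

theory Defs
  imports Complex_Main "HOL-Library.Tree" "HOL-Library.Poly_Mapping"
begin

section \<open>Permutations as words, and the algebra FQSym\<close>

typedef perm_word = "{w :: nat list. distinct w \<and> set w = {1..length w}}"
  morphisms letters Perm_Word
  by (rule exI[of _ "[]"]) simp

abbreviation psize :: "perm_word \<Rightarrow> nat"
  where "psize \<sigma> \<equiv> length (letters \<sigma>)"

text \<open>Only the algebra structure of FQSym is recorded. The product is not \<open>(*)\<close>,
  which on finitely supported functions is reserved for monoid-indexed convolution.\<close>

type_synonym 'k fqsym = "perm_word \<Rightarrow>\<^sub>0 'k"

definition F :: "perm_word \<Rightarrow> 'k::zero_neq_one fqsym"
  where "F \<sigma> = Poly_Mapping.single \<sigma> 1"

text \<open>The two shuffled words have no letter in common, so a word occurs at most once as a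
  shuffle and the set of all shuffles carries no multiplicities.\<close>

definition shifted_shuffles :: "perm_word \<Rightarrow> perm_word \<Rightarrow> perm_word set"
  where "shifted_shuffles \<sigma> \<nu> =
    {\<pi>. letters \<pi> \<in> shuffles (letters \<sigma>) (map (\<lambda>x. x + psize \<sigma>) (letters \<nu>))}"

definition fqsym_mult :: "'k::semiring_1 fqsym \<Rightarrow> 'k fqsym \<Rightarrow> 'k fqsym"  (infixl "\<bullet>" 70)
  where "f \<bullet> g = (\<Sum>\<sigma>\<in>Poly_Mapping.keys f. \<Sum>\<nu>\<in>Poly_Mapping.keys g. \<Sum>\<pi>\<in>shifted_shuffles \<sigma> \<nu>.
    Poly_Mapping.single \<pi> (Poly_Mapping.lookup f \<sigma> * Poly_Mapping.lookup g \<nu>))"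


section \<open>Pairs of twin binary trees\<close>

type_synonym btree = "unit tree"
type_synonym btree_pair = "btree \<times> btree"

text \<open>The leaves from left to right: 0 for a right child, 1 for a left child. The first argument
  is the value given to the root in case it is a leaf.\<close>

fun leaf_word :: "nat \<Rightarrow> btree \<Rightarrow> nat list"
  where
    "leaf_word d Leaf = [d]"
  | "leaf_word d (Node l _ r) = leaf_word 1 l @ leaf_word 0 r"

text \<open>The first and last leaves are dropped, so the argument 0 below is never visible.\<close>

definition canopy :: "btree \<Rightarrow> nat list"
  where "canopy t = butlast (tl (leaf_word 0 t))"

definition twin_pair :: "btree_pair \<Rightarrow> bool"
  where "twin_pair J \<longleftrightarrow> size (fst J) = size (snd J) \<and>
    (\<forall>i < size (fst J) - 1. canopy (fst J) ! i \<noteq> canopy (snd J) ! i)"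

fun bst_insert :: "nat \<Rightarrow> nat tree \<Rightarrow> nat tree"
  where
    "bst_insert x Leaf = Node Leaf x Leaf"
  | "bst_insert x (Node l a r) =
       (if x < a then Node (bst_insert x l) a r else Node l a (bst_insert x r))"

definition shape :: "'a tree \<Rightarrow> btree"
  where "shape = map_tree (\<lambda>_. ())"

definition P_symbol :: "perm_word \<Rightarrow> btree_pair"
  where "P_symbol \<sigma> =
    (shape (fold bst_insert (letters \<sigma>) Leaf),
     shape (fold bst_insert (rev (letters \<sigma>)) Leaf))"

definition P :: "btree_pair \<Rightarrow> 'k::{zero_neq_one,comm_monoid_add} fqsym"
  where "P J = (\<Sum>\<sigma> | P_symbol \<sigma> = J. F \<sigma>)"


section \<open>The Baxter order, and the elementary and homogeneous families\<close>

definition perm_cover :: "perm_word \<Rightarrow> perm_word \<Rightarrow> bool"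
  where "perm_cover \<sigma> \<nu> \<longleftrightarrow>
    (\<exists>u v a b. a < b \<and> letters \<sigma> = u @ [a, b] @ v \<and> letters \<nu> = u @ [b, a] @ v)"

definition perm_le :: "perm_word \<Rightarrow> perm_word \<Rightarrow> bool"  (infix "\<le>\<^sub>P" 50)
  where "perm_le = perm_cover\<^sup>*\<^sup>*"

definition baxter_le :: "btree_pair \<Rightarrow> btree_pair \<Rightarrow> bool"  (infix "\<le>\<^sub>B" 50)
  where "J\<^sub>0 \<le>\<^sub>B J\<^sub>1 \<longleftrightarrow>
    (\<exists>\<sigma> \<nu>. \<sigma> \<le>\<^sub>P \<nu> \<and> P_symbol \<sigma> = J\<^sub>0 \<and> P_symbol \<nu> = J\<^sub>1)"

definition E :: "btree_pair \<Rightarrow> 'k::{zero_neq_one,comm_monoid_add} fqsym"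
  where "E J = (\<Sum>J' | twin_pair J' \<and> J \<le>\<^sub>B J'. P J')"

definition H :: "btree_pair \<Rightarrow> 'k::{zero_neq_one,comm_monoid_add} fqsym"
  where "H J = (\<Sum>J' | twin_pair J' \<and> J' \<le>\<^sub>B J. P J')"


section \<open>Grafting\<close>

fun tree_over :: "btree \<Rightarrow> btree \<Rightarrow> btree"
  where
    "tree_over s Leaf = s"
  | "tree_over s (Node l x r) = Node (tree_over s l) x r"

fun tree_under :: "btree \<Rightarrow> btree \<Rightarrow> btree"
  where
    "tree_under Leaf t = t"
  | "tree_under (Node l x r) t = Node l x (tree_under r t)"

text \<open>On the left-hand trees, the two graftings are exchanged.\<close>

definition pair_over :: "btree_pair \<Rightarrow> btree_pair \<Rightarrow> btree_pair"
  where "pair_over J\<^sub>0 J\<^sub>1 = (tree_under (fst J\<^sub>0) (fst J\<^sub>1), tree_over (snd J\<^sub>0) (snd J\<^sub>1))"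

definition pair_under :: "btree_pair \<Rightarrow> btree_pair \<Rightarrow> btree_pair"
  where "pair_under J\<^sub>0 J\<^sub>1 = (tree_over (fst J\<^sub>0) (fst J\<^sub>1), tree_under (snd J\<^sub>0) (snd J\<^sub>1))"


section \<open>All sums above range over finite sets\<close>

lemma finite_psize: "finite {\<sigma>. psize \<sigma> = n}"
proof -
  have "letters ` {\<sigma>. psize \<sigma> = n} \<subseteq> {w. set w \<subseteq> {1..n} \<and> length w = n}"
    using letters by fastforce
  moreover have "finite {w. set w \<subseteq> {1..n} \<and> length w = n}"
    by (rule finite_lists_length_eq) simp
  ultimately have "finite (letters ` {\<sigma>. psize \<sigma> = n})"
    by (rule finite_subset)
  then show ?thesis
    by (rule finite_imageD) (simp add: inj_on_def letters_inject)
qed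

lemma size_bst_insert: "size (bst_insert x t) = Suc (size t)"
  by (induction t) auto

lemma size_P_symbol: "size (fst (P_symbol \<sigma>)) = psize \<sigma>" "size (snd (P_symbol \<sigma>)) = psize \<sigma>"
proof -
  have "size (fold bst_insert xs t) = length xs + size t" for xs t
    by (induction xs arbitrary: t) (auto simp: size_bst_insert)
  then show "size (fst (P_symbol \<sigma>)) = psize \<sigma>" "size (snd (P_symbol \<sigma>)) = psize \<sigma>"
    by (simp_all add: P_symbol_def shape_def)
qed

lemma finite_shifted_shuffles: "finite (shifted_shuffles \<sigma> \<nu>)"
  by (rule finite_subset[OF _ finite_psize[of "psize \<sigma> + psize \<nu>"]])
    (auto simp: shifted_shuffles_def dest: length_shuffles)

lemma finite_P_symbol_fibre: "finite {\<sigma>. P_symbol \<sigma> = J}"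
  by (rule finite_subset[OF _ finite_psize[of "size (fst J)"]]) (auto simp: size_P_symbol)

lemma psize_perm_le: "\<sigma> \<le>\<^sub>P \<nu> \<Longrightarrow> psize \<sigma> = psize \<nu>"
  unfolding perm_le_def by (induction rule: rtranclp_induct) (auto simp: perm_cover_def)

lemma finite_baxter_up: "finite {J'. twin_pair J' \<and> J \<le>\<^sub>B J'}"
  by (rule finite_subset[OF _ finite_imageI[OF finite_psize[of "size (fst J)"], of P_symbol]])
    (use psize_perm_le in \<open>force simp: baxter_le_def size_P_symbol\<close>)

lemma finite_baxter_down: "finite {J'. twin_pair J' \<and> J' \<le>\<^sub>B J}"
  by (rule finite_subset[OF _ finite_imageI[OF finite_psize[of "size (fst J)"], of P_symbol]])
    (use psize_perm_le in \<open>force simp: baxter_le_def size_P_symbol\<close>)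

lemma F_mult_F:
  "F \<sigma> \<bullet> F \<nu> = (\<Sum>\<pi>\<in>shifted_shuffles \<sigma> \<nu>. F \<pi> :: 'k::semiring_1 fqsym)"
  by (simp add: fqsym_mult_def F_def)

end

theory Submission
  imports Defs
begin

text \<open>In the binary search tree of a word \<open>w\<close>, a value \<open>x\<close> is an ancestor of \<open>y\<close> iff \<open>x\<close> comes first in
  \<open>w\<close> among the values between \<open>x\<close> and \<open>y\<close>. Hence for \<open>a < b\<close> the pair \<open>P(\<sigma>)\<close> forces \<open>b\<close> before \<open>a\<close>
  whenever \<open>b\<close> is an ancestor of \<open>a\<close> in the left tree or \<open>a\<close> an ancestor of \<open>b\<close> in the right tree.
  These forced inversions govern the Baxter order: \<open>P(\<sigma>) \<le> P(\<nu>)\<close> iff every forced inversion of \<open>\<sigma>\<close>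
  is one of \<open>\<nu>\<close>, with its side (left or right) preserved. The key point is that in a permutation
  with as few inversions as possible in its fibre of \<open>P\<close>, every inversion is a composition of forced
  ones. Consequently \<open>E\<^sub>J\<close> and \<open>H\<^sub>J\<close> are sums of \<open>F\<^sub>\<sigma>\<close> over sets given by forced inversions. A shuffle
  of \<open>\<sigma>\<close> and the shifted \<open>\<nu>\<close> is a word with prescribed restrictions to small and to large letters,
  and \<open>P(\<sigma>) / P(\<nu>)\<close> has no forced inversion between a small and a large letter, whereas
  \<open>P(\<sigma>) \ P(\<nu>)\<close> has all those compatible with the forced inversions of \<open>\<sigma>\<close> and \<open>\<nu>\<close>.\<close>

section \<open>Words and binary search trees\<close>

primrec before :: "'a list \<Rightarrow> 'a \<Rightarrow> 'a \<Rightarrow> bool"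
  where
    "before [] x y \<longleftrightarrow> False"
  | "before (z # w) x y \<longleftrightarrow> x = z \<and> y \<in> set w \<or> before w x y"

lemma before_in_set: "before w x y \<Longrightarrow> x \<in> set w \<and> y \<in> set w"
  by (induction w) auto

lemma before_append:
  "before (u @ v) x y \<longleftrightarrow> before u x y \<or> before v x y \<or> x \<in> set u \<and> y \<in> set v"
  by (induction u) auto

lemma before_rev: "before (rev w) x y \<longleftrightarrow> before w y x"
  by (induction w) (auto simp: before_append)

lemma before_filter: "before (filter I w) x y \<longleftrightarrow> before w x y \<and> I x \<and> I y"
  by (induction w) (auto dest: before_in_set)

lemma before_map: "inj f \<Longrightarrow> before (map f w) (f x) (f y) \<longleftrightarrow> before w x y"
  by (induction w) (auto simp: inj_eq inj_image_mem_iff)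

lemma before_total: "x \<in> set w \<Longrightarrow> y \<in> set w \<Longrightarrow> x \<noteq> y \<Longrightarrow> before w x y \<or> before w y x"
  by (induction w) auto

lemma before_antisym: "distinct w \<Longrightarrow> before w x y \<Longrightarrow> \<not> before w y x"
  by (induction w) (auto dest: before_in_set)

lemma before_trans: "distinct w \<Longrightarrow> before w x y \<Longrightarrow> before w y z \<Longrightarrow> before w x z"
  by (induction w) (auto dest: before_in_set)

lemma before_split: "before w x y \<Longrightarrow> \<exists>u m v. w = u @ x # m @ y # v"
proof (induction w)
  case (Cons z w)
  show ?case
  proof (cases "before w x y")
    case True
    with Cons.IH obtain u m v where "w = u @ x # m @ y # v" by blast
    then have "z # w = (z # u) @ x # m @ y # v" by simp
    then show ?thesis by blast
  next
    case False
    with Cons.prems have "x = z" "y \<in> set w" by auto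
    then show ?thesis by (metis append_Nil split_list)
  qed
qed simp

text \<open>For distinct \<open>w\<close> this is the ancestor relation of the binary search tree,
  each node being its own ancestor. It mentions no tree, so it can be compared across words and
  restricted to intervals of values.\<close>

definition leads :: "nat list \<Rightarrow> nat \<Rightarrow> nat \<Rightarrow> bool"
  where "leads w x y \<longleftrightarrow> x \<in> set w \<and> y \<in> set w \<and>
    (\<forall>z \<in> set w. z \<in> {min x y..max x y} \<and> z \<noteq> x \<longrightarrow> before w x z)"

lemma leads_filter:
  assumes "\<And>z. z \<in> {min x y..max x y} \<Longrightarrow> I z"
  shows "leads (filter I w) x y \<longleftrightarrow> leads w x y"
proof -
  have "I x" "I y" by (rule assms, simp)+
  then show ?thesis using assms by (auto simp: leads_def before_filter)
qed

lemma leads_in_set: "leads w x y \<Longrightarrow> x \<in> set w \<and> y \<in> set w"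
  by (simp add: leads_def)

lemma leads_shift: "leads (map (\<lambda>z. z + n) w) (x + n) (y + n) \<longleftrightarrow> leads w x y"
proof -
  have inj: "inj (\<lambda>z. z + n)" by (simp add: inj_def)
  have "min (x + n) (y + n) = min x y + n" "max (x + n) (y + n) = max x y + n"
    by auto
  then show ?thesis
    by (simp add: leads_def before_map[OF inj] inj_image_mem_iff[OF inj])
qed

section \<open>Shapes of binary search trees, by recursion on the first letter\<close>

definition bst_shape :: "nat list \<Rightarrow> btree"
  where "bst_shape w = shape (fold bst_insert w Leaf)"

lemma bst_Nil [simp]: "bst_shape [] = Leaf"
  by (simp add: bst_shape_def shape_def)

text \<open>The first letter stays at the root and routes every later letter to one side, so the two
  subtrees grow independently. Generalizing over the subtrees \<open>l\<close> and \<open>r\<close>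
  lets the induction on \<open>w\<close> go through.\<close>

lemma bst_Cons [simp]:
  "bst_shape (x # w) = Node (bst_shape (filter (\<lambda>y. y < x) w)) () (bst_shape (filter (\<lambda>y. x \<le> y) w))"
proof -
  have "fold bst_insert w (Node l x r) =
      Node (fold bst_insert (filter (\<lambda>y. y < x) w) l) x (fold bst_insert (filter (\<lambda>y. x \<le> y) w) r)"
    for l r
    by (induction w arbitrary: l r) auto
  then show ?thesis by (simp add: bst_shape_def shape_def)
qed

text \<open>The induction scheme of quicksort, in step with the recursion of
  \<open>bst_shape\<close>.\<close>

lemma bst_induct [case_names Nil Cons]:
  assumes "Q []"
    and "\<And>x w. Q (filter (\<lambda>y. y < x) w) \<Longrightarrow> Q (filter (\<lambda>y. x \<le> y) w) \<Longrightarrow> Q (x # w)"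
  shows "Q (w :: nat list)"
proof (induction w rule: length_induct)
  case (1 w)
  show ?case
  proof (cases w)
    case (Cons x u)
    have "length (filter I u) < length w" for I
      by (simp add: Cons le_imp_less_Suc)
    with 1 assms(2) Cons show ?thesis by simp
  qed (use assms(1) in simp)
qed

lemma size_bst [simp]: "size (bst_shape w) = length w"
  by (induction w rule: bst_induct)
    (simp_all add: not_less [symmetric] sum_length_filter_compl)

lemma bst_eq_Leaf_iff [simp]: "bst_shape w = Leaf \<longleftrightarrow> w = []"
  by (cases w) auto

lemma bst_shift: "bst_shape (map (\<lambda>x. x + n) w) = bst_shape w"
  by (induction w rule: bst_induct) (simp_all add: filter_map o_def)

text \<open>Every letter of \<open>v\<close> exceeds the labels coming from \<open>u\<close>, so it
  passes down their right spine, and the letters of \<open>v\<close> build their own tree on the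
  rightmost leaf.\<close>

lemma bst_append_under:
  "\<forall>x \<in> set u. \<forall>y \<in> set v. x < y \<Longrightarrow> bst_shape (u @ v) = tree_under (bst_shape u) (bst_shape v)"
proof (induction u rule: bst_induct)
  case (Cons x u)
  then have "filter (\<lambda>y. y < x) v = []" "filter (\<lambda>y. x \<le> y) v = v"
    by (auto simp: filter_empty_conv filter_id_conv)
  with Cons show ?case by simp
qed simp

lemma bst_append_over:
  "\<forall>x \<in> set u. \<forall>y \<in> set v. x < y \<Longrightarrow> bst_shape (v @ u) = tree_over (bst_shape u) (bst_shape v)"
proof (induction v rule: bst_induct)
  case (Cons y v)
  then have "filter (\<lambda>x. x < y) u = u" "filter (\<lambda>x. y \<le> x) u = []"
    by (auto simp: filter_empty_conv filter_id_conv not_le)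
  with Cons show ?case by simp
qed simp

text \<open>The intermediate value \<open>z\<close> sends \<open>p\<close> and \<open>q\<close> into different subtrees before they can be compared.\<close>

lemma bst_swap:
  "\<exists>z \<in> set u. min p q < z \<and> z < max p q \<Longrightarrow> bst_shape (u @ p # q # v) = bst_shape (u @ q # p # v)"
proof (induction u arbitrary: v rule: bst_induct)
  case (Cons x u)
  then obtain z where z: "z \<in> set (x # u)" "min p q < z" "z < max p q" by blast
  consider "p < x \<and> q < x" | "x \<le> p \<and> x \<le> q" | "p < x \<and> x \<le> q" | "q < x \<and> x \<le> p" by linarith
  then show ?case
  proof cases
    case 1
    then have "\<exists>z \<in> set (filter (\<lambda>y. y < x) u). min p q < z \<and> z < max p q"
      using z by (intro bexI[of _ z]) auto
    with 1 Cons.IH(1) show ?thesis by simp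
  next
    case 2
    then have "\<exists>z \<in> set (filter (\<lambda>y. x \<le> y) u). min p q < z \<and> z < max p q"
      using z by (intro bexI[of _ z]) auto
    with 2 Cons.IH(2) show ?thesis by (simp add: not_less)
  qed auto
qed simp

section \<open>Recovering the ancestor relation from the shape\<close>

lemma length_filter_eq_card: "distinct w \<Longrightarrow> length (filter I w) = card {x \<in> set w. I x}"
  by (metis distinct_card distinct_filter set_filter)

lemma leads_Cons:
  assumes "x \<notin> set v"
  shows "leads (x # v) p q \<longleftrightarrow>
    (if p = x then q \<in> set (x # v)
     else leads (filter (\<lambda>y. y < x) v) p q \<or> leads (filter (\<lambda>y. x \<le> y) v) p q)"
proof (cases "p = x")
  case True
  then show ?thesis by (auto simp: leads_def)
next
  case False
  consider "p < x \<and> q < x" | "x < p \<and> x < q" | "min p q \<le> x \<and> x \<le> max p q"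
    by linarith
  then show ?thesis
  proof cases
    case 1
    then have "leads (filter (\<lambda>y. y < x) (x # v)) p q \<longleftrightarrow> leads (x # v) p q"
      by (intro leads_filter) auto
    moreover have "\<not> leads (filter (\<lambda>y. x \<le> y) v) p q"
      using 1 by (auto dest: leads_in_set)
    ultimately show ?thesis using False by simp
  next
    case 2
    then have "leads (filter (\<lambda>y. x < y) (x # v)) p q \<longleftrightarrow> leads (x # v) p q"
      by (intro leads_filter) auto
    moreover have "filter (\<lambda>y. x < y) (x # v) = filter (\<lambda>y. x \<le> y) v"
      using assms by (auto intro!: filter_cong) (metis le_neq_implies_less)
    moreover have "\<not> leads (filter (\<lambda>y. y < x) v) p q"
      using 2 by (auto dest: leads_in_set)
    ultimately show ?thesis using False by simp
  next
    case 3
    \<comment> \<open>The root \<open>x\<close> belongs to the interval and comes first, so a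
      different value \<open>p\<close> cannot lead.\<close>
    have "\<not> before (x # v) p x" using assms False by (auto dest: before_in_set)
    with 3 False have "\<not> leads (x # v) p q" by (auto simp: leads_def)
    moreover have "\<not> (p < x \<and> q < x)" "x \<le> p \<and> x \<le> q \<longrightarrow> q = x" using 3 False by linarith+
    then have "\<not> leads (filter (\<lambda>y. y < x) v) p q" "\<not> leads (filter (\<lambda>y. x \<le> y) v) p q"
      using assms by (auto dest!: leads_in_set)
    ultimately show ?thesis using False by simp
  qed
qed

text \<open>The size of the left subtree is the number of labels below the root label, so shape and
  label set together determine the labelled tree, hence its ancestor relation.\<close>

lemma leads_cong_bst:
  assumes "bst_shape w = bst_shape w'" "distinct w" "distinct w'" "set w = set w'"
  shows "leads w p q \<longleftrightarrow> leads w' p q"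
  using assms
proof (induction w arbitrary: w' rule: bst_induct)
  case (Cons x u)
  then obtain x' u' where w': "w' = x' # u'" by (cases w') auto
  let ?S = "set (x # u)"
  have "length (filter (\<lambda>y. y < x) u) = length (filter (\<lambda>y. y < x') u')"
    using Cons.prems(1) by (metis w' bst_Cons size_bst tree.inject)
  then have "length (filter (\<lambda>y. y < x) (x # u)) = length (filter (\<lambda>y. y < x') w')"
    by (simp add: w')
  then have card: "card {y \<in> ?S. y < x} = card {y \<in> ?S. y < x'}"
    using Cons.prems by (simp only: length_filter_eq_card)
  have "x' \<in> ?S" using Cons.prems(4) w' by simp
  \<comment> \<open>Strictness comes from \<open>s\<close> itself; equal counts of smaller letters
    therefore force equal roots.\<close>
  have card_less: "card {y \<in> ?S. y < s} < card {y \<in> ?S. y < t}" if "s < t" "s \<in> ?S" for s t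
  proof (rule psubset_card_mono)
    show "{y \<in> ?S. y < s} \<subset> {y \<in> ?S. y < t}"
      using that less_trans[OF _ that(1)] by blast
  qed simp
  have x': "x' = x"
  proof (cases x x' rule: linorder_cases)
    case less
    with card_less[of x x'] card show ?thesis by simp
  next
    case greater
    with card_less[of x' x] card \<open>x' \<in> ?S\<close> show ?thesis by simp
  qed simp
  have nx: "x \<notin> set u" "x \<notin> set u'" using Cons.prems(2,3) w' x' by simp_all
  then have sets: "set u = set u'" using Cons.prems(4) by (simp add: w' x' insert_ident)
  have eq: "bst_shape (filter (\<lambda>y. y < x) u) = bst_shape (filter (\<lambda>y. y < x) u')"
    "bst_shape (filter (\<lambda>y. x \<le> y) u) = bst_shape (filter (\<lambda>y. x \<le> y) u')"
    and d: "distinct u" "distinct u'"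
    using Cons.prems(1-3) by (simp_all add: w' x')
  have low: "leads (filter (\<lambda>y. y < x) u) p q \<longleftrightarrow> leads (filter (\<lambda>y. y < x) u') p q"
    by (rule Cons.IH(1)[OF eq(1)]) (simp_all add: d sets)
  have high: "leads (filter (\<lambda>y. x \<le> y) u) p q \<longleftrightarrow> leads (filter (\<lambda>y. x \<le> y) u') p q"
    by (rule Cons.IH(2)[OF eq(2)]) (simp_all add: d sets)
  show ?case unfolding w' x' leads_Cons[OF nx(1)] leads_Cons[OF nx(2)] using low high sets by simp
qed (auto simp: leads_def)

section \<open>Cutting a grafted tree back into its factors\<close>

text \<open>The nodes of \<open>t\<^sub>0\<close> carry the smallest labels, and \<open>k\<close> is
  a threshold with exactly that many letters up to it. The induction descends the right spine of
  \<open>t\<^sub>0\<close>.\<close>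

lemma bst_under_split:
  assumes "bst_shape w = tree_under t\<^sub>0 t\<^sub>1" "distinct w" "length (filter (\<lambda>x. x \<le> k) w) = size t\<^sub>0"
  shows "bst_shape (filter (\<lambda>x. x \<le> k) w) = t\<^sub>0 \<and> bst_shape (filter (\<lambda>x. \<not> x \<le> k) w) = t\<^sub>1"
  using assms
proof (induction t\<^sub>0 arbitrary: w)
  case Leaf
  then have "filter (\<lambda>x. \<not> x \<le> k) w = w" by (simp add: filter_empty_conv filter_id_conv)
  with Leaf show ?case by simp
next
  case (Node l i r)
  then obtain x u where w: "w = x # u" by (cases w) auto
  have l: "l = bst_shape (filter (\<lambda>y. y < x) u)"
    and r: "bst_shape (filter (\<lambda>y. x \<le> y) u) = tree_under r t\<^sub>1"
    using Node.prems(1) w by auto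
  \<comment> \<open>If the root exceeded \<open>k\<close>, all letters up to \<open>k\<close> would
    lie in its left subtree, which has fewer nodes than the tree to be cut off.\<close>
  have "x \<le> k"
  proof (rule ccontr)
    assume "\<not> x \<le> k"
    then have "card {y \<in> set w. y \<le> k} \<le> card {y \<in> set w. y < x}" by (intro card_mono) auto
    then have "length (filter (\<lambda>y. y \<le> k) w) \<le> length (filter (\<lambda>y. y < x) w)"
      using Node.prems(2) by (simp only: length_filter_eq_card)
    then show False using Node.prems(3) by (simp add: w l)
  qed
  then have low: "filter (\<lambda>y. y < x) (filter (\<lambda>y. y \<le> k) u) = filter (\<lambda>y. y < x) u"
    and mid: "filter (\<lambda>y. x \<le> y) (filter (\<lambda>y. y \<le> k) u) = filter (\<lambda>y. y \<le> k) (filter (\<lambda>y. x \<le> y) u)"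
    and high: "filter (\<lambda>y. \<not> y \<le> k) w = filter (\<lambda>y. \<not> y \<le> k) (filter (\<lambda>y. x \<le> y) u)"
    by (auto simp: w intro!: filter_cong)
  have "length (filter (\<lambda>y. y \<le> k) u) =
      length (filter (\<lambda>y. y < x) (filter (\<lambda>y. y \<le> k) u)) +
      length (filter (\<lambda>y. \<not> y < x) (filter (\<lambda>y. y \<le> k) u))"
    by (simp only: sum_length_filter_compl)
  then have len: "length (filter (\<lambda>y. y \<le> k) (filter (\<lambda>y. x \<le> y) u)) = size r"
    using Node.prems(3) \<open>x \<le> k\<close> unfolding low mid not_less by (simp add: w l)
  have "bst_shape (filter (\<lambda>y. y \<le> k) (filter (\<lambda>y. x \<le> y) u)) = r"
    "bst_shape (filter (\<lambda>y. \<not> y \<le> k) (filter (\<lambda>y. x \<le> y) u)) = t\<^sub>1"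
    using Node.IH(2)[OF r _ len] Node.prems(2) w by (auto simp del: filter_filter)
  then show ?case unfolding high using \<open>x \<le> k\<close> by (simp add: w l low mid del: filter_filter)
qed

text \<open>Again \<open>t\<^sub>0\<close> carries the smallest labels, but it now hangs at the end
  of the left spine of \<open>t\<^sub>1\<close>, which the induction descends.\<close>

lemma bst_over_split:
  assumes "bst_shape w = tree_over t\<^sub>0 t\<^sub>1" "distinct w" "length (filter (\<lambda>x. x \<le> k) w) = size t\<^sub>0"
  shows "bst_shape (filter (\<lambda>x. x \<le> k) w) = t\<^sub>0 \<and> bst_shape (filter (\<lambda>x. \<not> x \<le> k) w) = t\<^sub>1"
  using assms
proof (induction t\<^sub>1 arbitrary: w)
  case Leaf
  then have "length (filter (\<lambda>x. x \<le> k) w) = length w" by (metis size_bst tree_over.simps(1))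
  then have "length (filter (\<lambda>x. \<not> x \<le> k) w) = 0"
    using sum_length_filter_compl[of "\<lambda>x. x \<le> k" w] by linarith
  then have "filter (\<lambda>x. x \<le> k) w = w" "filter (\<lambda>x. \<not> x \<le> k) w = []"
    by (auto simp: filter_empty_conv filter_id_conv simp del: not_le)
  with Leaf show ?case by simp
next
  case (Node l i r)
  then obtain x u where w: "w = x # u" by (cases w) auto
  have l: "bst_shape (filter (\<lambda>y. y < x) u) = tree_over t\<^sub>0 l"
    and r: "r = bst_shape (filter (\<lambda>y. x \<le> y) u)"
    using Node.prems(1) w by auto
  have size_over: "size t\<^sub>0 \<le> size (tree_over t\<^sub>0 l)" by (induction l) auto
  \<comment> \<open>A root of value at most \<open>k\<close> would, together with its left subtree,
    give more letters up to \<open>k\<close> than \<open>t\<^sub>0\<close> has nodes.\<close>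
  have "\<not> x \<le> k"
  proof
    assume "x \<le> k"
    then have "card {y \<in> set w. y < x} < card {y \<in> set w. y \<le> k}"
      by (intro psubset_card_mono) (auto simp: w)
    then have "length (filter (\<lambda>y. y < x) w) < length (filter (\<lambda>y. y \<le> k) w)"
      using Node.prems(2) by (simp only: length_filter_eq_card)
    then show False using Node.prems(3) size_over by (simp add: w flip: l)
  qed
  then have low: "filter (\<lambda>y. y \<le> k) w = filter (\<lambda>y. y \<le> k) (filter (\<lambda>y. y < x) u)"
    and mid: "filter (\<lambda>y. y < x) (filter (\<lambda>y. \<not> y \<le> k) u) = filter (\<lambda>y. \<not> y \<le> k) (filter (\<lambda>y. y < x) u)"
    and high: "filter (\<lambda>y. x \<le> y) (filter (\<lambda>y. \<not> y \<le> k) u) = filter (\<lambda>y. x \<le> y) u"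
    by (auto simp: w intro!: filter_cong)
  have "bst_shape (filter (\<lambda>y. y \<le> k) (filter (\<lambda>y. y < x) u)) = t\<^sub>0 \<and>
    bst_shape (filter (\<lambda>y. \<not> y \<le> k) (filter (\<lambda>y. y < x) u)) = l"
    by (rule Node.IH(1)[OF l]) (use Node.prems(2,3) in \<open>simp_all only: low, simp add: w\<close>)
  then show ?case unfolding low using \<open>\<not> x \<le> k\<close> by (simp add: w r mid high del: filter_filter)
qed

section \<open>Canopies\<close>

lemma length_leaf_word [simp]: "length (leaf_word d t) = Suc (size t)"
  by (induction t arbitrary: d) auto

lemma leaf_word_first: "leaf_word d t ! 0 = (if t = Leaf then d else 1)"
proof (induction t arbitrary: d)
  case (Node l i r)
  then show ?case by (simp add: nth_append)
qed simp

lemma leaf_word_last: "leaf_word d t ! size t = (if t = Leaf then d else 0)"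
proof (induction t arbitrary: d)
  case (Node l i r)
  then show ?case by (simp add: nth_append)
qed simp

text \<open>The leaf between two consecutive values hangs from the one inserted later: as left child
  of the larger, or as right child of the smaller. Leaf \<open>0\<close> lies left of all values, so
  leaf \<open>Suc j\<close> separates \<open>m + j\<close> from \<open>m + Suc j\<close>. The offset
  \<open>m\<close> lets the statement pass to right subtrees.\<close>

lemma leaf_word_bst:
  assumes "distinct w" "set w = {m..<m + n}" "Suc j < n"
  shows "leaf_word d (bst_shape w) ! Suc j = (if before w (m + j) (m + Suc j) then 1 else 0)"
  using assms
proof (induction w arbitrary: m n j d rule: bst_induct)
  case (Cons x u)
  have x: "m \<le> x" "x < m + n" using Cons.prems(2) by auto
  have nx: "x \<notin> set u" using Cons.prems(1) by simp
  have su: "set u = {m..<m + n} - {x}" using Cons.prems(2) nx by auto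
  let ?l = "filter (\<lambda>y. y < x) u" and ?r = "filter (\<lambda>y. x \<le> y) u"
  have "set ?l = {m..<x}" using x su by fastforce
  then have sl: "set ?l = {m..<m + (x - m)}" using x by simp
  have "set ?r = {Suc x..<m + n}" using x su by fastforce
  then have sr: "set ?r = {Suc x..<Suc x + (m + n - Suc x)}" using x by simp
  have "length ?l = card (set ?l)" using Cons.prems(1) by (subst distinct_card) simp_all
  then have ll: "length ?l = x - m" unfolding sl by simp
  consider "Suc j < x - m" | "Suc j = x - m" | "j = x - m" | "x - m < j" by linarith
  then show ?case
  proof cases
    case 1
    have "before ?l (m + j) (m + Suc j) \<longleftrightarrow> before (x # u) (m + j) (m + Suc j)"
      using 1 by (auto simp: before_filter)
    then show ?thesis using Cons.IH(1)[OF _ sl 1, of 1] Cons.prems(1) 1 ll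
      by (simp add: nth_append del: before.simps)
  next
    case 2
    then have "?l \<noteq> []" using ll by auto
    have "m + Suc j = x" using 2 x by simp
    have "leaf_word 1 (bst_shape ?l) ! Suc j = 0"
      using leaf_word_last[of 1 "bst_shape ?l"] 2 ll \<open>?l \<noteq> []\<close> by simp
    moreover have "\<not> before (x # u) (m + j) x"
      using nx \<open>m + Suc j = x\<close> by (auto dest: before_in_set)
    ultimately show ?thesis
      unfolding \<open>m + Suc j = x\<close> using 2 ll by (simp add: nth_append del: before.simps)
  next
    case 3
    then have "m + j = x" "m + Suc j \<in> set u" using x su Cons.prems(3) by auto
    moreover from this have "?r \<noteq> []" by (fastforce simp: filter_empty_conv)
    ultimately show ?thesis using 3 ll leaf_word_first[of 0 "bst_shape ?r"]
      by (simp add: nth_append)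
  next
    case 4
    \<comment> \<open>The left subtree contributes \<open>Suc (x - m)\<close> leaves, so leaf
      \<open>Suc j\<close> is leaf \<open>Suc j'\<close> of the right subtree.\<close>
    define j' where "j' = j - Suc (x - m)"
    have j: "j = Suc (x - m) + j'" using 4 by (simp add: j'_def)
    then have "Suc j' < m + n - Suc x" using Cons.prems(3) x by auto
    from Cons.IH(2)[OF _ sr this] have
      "leaf_word 0 (bst_shape ?r) ! Suc j' = (if before ?r (Suc x + j') (Suc x + Suc j') then 1 else 0)"
      using Cons.prems(1) by simp
    moreover have mj: "m + j = Suc x + j'" using j x by simp
    moreover have "before ?r (Suc x + j') (Suc x + Suc j') \<longleftrightarrow>
        before (x # u) (Suc x + j') (Suc x + Suc j')"
      by (auto simp: before_filter)
    moreover have "(leaf_word 1 (bst_shape ?l) @ leaf_word 0 (bst_shape ?r)) ! Suc j =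
        leaf_word 0 (bst_shape ?r) ! Suc j'"
      using j ll by (simp add: nth_append)
    ultimately show ?thesis by (simp del: before.simps)
  qed
qed simp

section \<open>Permutations and their pairs of trees\<close>

lemma distinct_letters: "distinct (letters \<sigma>)" and set_letters: "set (letters \<sigma>) = {1..psize \<sigma>}"
  using letters[of \<sigma>] by auto

lemma perm_word_exists:
  assumes "distinct w" "set w = {1..n}"
  obtains \<sigma> where "letters \<sigma> = w" "psize \<sigma> = n"
proof -
  have "length w = n" using distinct_card[OF assms(1)] assms(2) by simp
  with assms have "letters (Perm_Word w) = w" by (intro Perm_Word_inverse) simp
  with \<open>length w = n\<close> that show ?thesis by metis
qed

lemma P_symbol_bst: "P_symbol \<sigma> = (bst_shape (letters \<sigma>), bst_shape (rev (letters \<sigma>)))"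
  by (simp add: P_symbol_def bst_shape_def)

text \<open>\<open>canopy\<close> drops leaf \<open>0\<close>, so its position \<open>i\<close> is
  leaf \<open>Suc i\<close>, between the values \<open>Suc i\<close> and
  \<open>Suc (Suc i)\<close>.\<close>

lemma canopy_bst:
  assumes "distinct w" "set w = {1..n}" "i < n - 1"
  shows "canopy (bst_shape w) ! i = (if before w (Suc i) (Suc (Suc i)) then 1 else 0)"
proof -
  have "length w = n" using distinct_card[OF assms(1)] assms(2) by simp
  then have "canopy (bst_shape w) ! i = leaf_word 0 (bst_shape w) ! Suc i"
    using assms(3) by (simp add: canopy_def nth_butlast nth_tl)
  moreover have "set w = {1..<1 + n}" unfolding assms(2) by auto
  moreover have "Suc i < n" using assms(3) by linarith
  ultimately show ?thesis using leaf_word_bst[OF assms(1), of 1 n i 0] by simp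
qed

text \<open>A canopy records only the relative order of consecutive values, and reversal flips each
  of these. Hence sums over twin pairs reach every permutation.\<close>

lemma twin_pair_P_symbol: "twin_pair (P_symbol \<sigma>)"
proof -
  let ?w = "letters \<sigma>"
  have "canopy (bst_shape ?w) ! i \<noteq> canopy (bst_shape (rev ?w)) ! i" if i: "i < psize \<sigma> - 1" for i
  proof -
    have "Suc i \<in> set ?w" "Suc (Suc i) \<in> set ?w" using i unfolding set_letters by auto
    then have "before ?w (Suc i) (Suc (Suc i)) \<or> before ?w (Suc (Suc i)) (Suc i)"
      by (rule before_total) simp
    moreover have "\<not> (before ?w (Suc i) (Suc (Suc i)) \<and> before ?w (Suc (Suc i)) (Suc i))"
      using before_antisym[OF distinct_letters] by blast
    moreover have "canopy (bst_shape (rev ?w)) ! i = (if before (rev ?w) (Suc i) (Suc (Suc i)) then 1 else 0)"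
      by (rule canopy_bst[OF _ _ i]) (simp_all only: distinct_rev set_rev distinct_letters set_letters)
    ultimately show ?thesis
      by (auto simp: before_rev canopy_bst[OF distinct_letters set_letters i])
  qed
  then show ?thesis by (simp add: twin_pair_def P_symbol_bst)
qed

section \<open>Inversions and the weak order\<close>

definition inversions :: "nat list \<Rightarrow> (nat \<times> nat) set"
  where "inversions w = {(b, a). a < b \<and> before w b a}"

lemma finite_inversions [simp]: "finite (inversions w)"
  by (rule finite_subset[of _ "set w \<times> set w"]) (auto simp: inversions_def dest: before_in_set)

lemma inversions_swap:
  assumes "distinct (u @ a # b # v)" "a < b"
  shows "inversions (u @ b # a # v) = insert (b, a) (inversions (u @ a # b # v))"
    and "(b, a) \<notin> inversions (u @ a # b # v)"
proof -
  have "before (u @ b # a # v) x y \<or> x = a \<and> y = b \<longleftrightarrow> before (u @ a # b # v) x y \<or> x = b \<and> y = a" for x y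
    by (simp add: before_append) blast
  with assms(2) show "inversions (u @ b # a # v) = insert (b, a) (inversions (u @ a # b # v))"
    by (fastforce simp: inversions_def)
  have "before (u @ a # b # v) a b" by (simp add: before_append)
  then show "(b, a) \<notin> inversions (u @ a # b # v)"
    using before_antisym[OF assms(1)] by (simp add: inversions_def)
qed

lemma before_chain:
  assumes "distinct w'" "\<And>u x y v. w = u @ x # y # v \<Longrightarrow> before w' x y"
  shows "w = u @ x # m @ y # v \<Longrightarrow> before w' x y"
proof (induction m arbitrary: u x)
  case Nil
  then show ?case using assms(2)[of u x y v] by simp
next
  case (Cons z m)
  have "before w' x z" using assms(2)[of u x z "m @ y # v"] Cons.prems by simp
  moreover have "before w' z y" using Cons.IH[of "u @ [x]" z] Cons.prems by simp
  ultimately show ?case using before_trans[OF assms(1)] by blast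
qed

lemma before_determines_word:
  assumes "distinct w" "distinct w'" "set w = set w'" "\<And>x y. before w x y \<Longrightarrow> before w' x y"
  shows "w = w'"
  using assms
proof (induction w arbitrary: w')
  case (Cons x u)
  then obtain x' u' where w': "w' = x' # u'" by (cases w') auto
  have "x = x'"
  proof (rule ccontr)
    assume "x \<noteq> x'"
    moreover have "x' \<in> set (x # u)" using Cons.prems(3) w' by simp
    ultimately have "before w' x x'" by (intro Cons.prems(4)) auto
    then show False using w' \<open>x \<noteq> x'\<close> Cons.prems(2) by (auto dest: before_in_set)
  qed
  have "u = u'"
  proof (rule Cons.IH)
    show d: "distinct u" "distinct u'" using Cons.prems w' by auto
    show "set u = set u'" using Cons.prems(1-3) w' \<open>x = x'\<close> by (simp add: insert_ident)
    show "before u' p q" if "before u p q" for p q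
      using Cons.prems(1) Cons.prems(4)[of p q] that w' \<open>x = x'\<close> by (auto dest: before_in_set)
  qed
  with w' \<open>x = x'\<close> show ?case by simp
qed simp

text \<open>Otherwise every adjacent pair of \<open>w\<close> keeps its order in \<open>w'\<close>:
  descents by inclusion of inversions, ascents because none of them is inverted in
  \<open>w'\<close>. By transitivity all pairs then agree, and the words coincide.\<close>

lemma ascent_towards:
  assumes "distinct w" "distinct w'" "set w = set w'" "inversions w \<subseteq> inversions w'" "w \<noteq> w'"
  obtains u a b v where "w = u @ a # b # v" "a < b" "(b, a) \<in> inversions w'"
proof (rule ccontr)
  note found = that
  assume none: "\<not> thesis"
  have adj: "before w' x y" if w: "w = u @ x # y # v" for u x y v
  proof (cases "x < y")
    case True
    then have "\<not> before w' y x" using none found[OF w True] True unfolding inversions_def by blast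
    moreover have "x \<in> set w'" "y \<in> set w'" using assms(3) w by auto
    ultimately show ?thesis using True before_total[of x w' y] by blast
  next
    case False
    then have "y < x" using assms(1) w by (simp add: not_less le_less)
    then have "(x, y) \<in> inversions w" using w by (simp add: inversions_def before_append)
    then show ?thesis using assms(4) by (auto simp: inversions_def)
  qed
  have "before w' x y" if "before w x y" for x y
  proof -
    from before_split[OF that] obtain u m v where w: "w = u @ x # m @ y # v" by blast
    show ?thesis by (rule before_chain[OF assms(2) _ w]) (rule adj)
  qed
  then have "w = w'" by (rule before_determines_word[OF assms(1-3)])
  with assms(5) show False ..
qed

text \<open>The classical description of the weak order. From inclusion to order, each step swaps an
  ascent of \<sigma> that is inverted in \<nu>, and the number of missing inversions drops.\<close>

lemma perm_le_iff_inversions: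
  "\<sigma> \<le>\<^sub>P \<nu> \<longleftrightarrow> psize \<sigma> = psize \<nu> \<and> inversions (letters \<sigma>) \<subseteq> inversions (letters \<nu>)"
proof
  assume le: "\<sigma> \<le>\<^sub>P \<nu>"
  have "inversions (letters \<sigma>) \<subseteq> inversions (letters \<nu>)"
    using le unfolding perm_le_def
  proof (induction rule: rtranclp_induct)
    case (step \<nu> \<nu>')
    then obtain u v a b where "a < b" "letters \<nu> = u @ a # b # v" "letters \<nu>' = u @ b # a # v"
      by (auto simp: perm_cover_def)
    with step.IH inversions_swap(1)[of u a b v] distinct_letters[of \<nu>] show ?case by auto
  qed simp
  with psize_perm_le[OF le]
  show "psize \<sigma> = psize \<nu> \<and> inversions (letters \<sigma>) \<subseteq> inversions (letters \<nu>)" by simp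
next
  assume "psize \<sigma> = psize \<nu> \<and> inversions (letters \<sigma>) \<subseteq> inversions (letters \<nu>)"
  then show "\<sigma> \<le>\<^sub>P \<nu>"
  proof (induction "card (inversions (letters \<nu>)) - card (inversions (letters \<sigma>))" arbitrary: \<sigma> rule: less_induct)
    case less
    show ?case
    proof (cases "letters \<sigma> = letters \<nu>")
      case True
      then show ?thesis by (simp add: letters_inject perm_le_def)
    next
      case False
      have sets: "set (letters \<sigma>) = set (letters \<nu>)" using less.prems by (simp add: set_letters)
      from ascent_towards[OF distinct_letters distinct_letters sets _ False] less.prems
      obtain u a b v where w: "letters \<sigma> = u @ a # b # v" "a < b"
        and inv: "(b, a) \<in> inversions (letters \<nu>)" by blast
      have d: "distinct (u @ a # b # v)" using distinct_letters[of \<sigma>] w by simp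
      have "distinct (u @ b # a # v)" "set (u @ b # a # v) = {1..psize \<sigma>}"
        using d set_letters[of \<sigma>] w(1) by auto
      then obtain \<sigma>' where \<sigma>': "letters \<sigma>' = u @ b # a # v" "psize \<sigma>' = psize \<sigma>"
        by (rule perm_word_exists)
      have inv': "inversions (letters \<sigma>') = insert (b, a) (inversions (letters \<sigma>))"
        "(b, a) \<notin> inversions (letters \<sigma>)"
        unfolding \<sigma>'(1) w(1) by (rule inversions_swap[OF d w(2)])+
      then have sub: "inversions (letters \<sigma>') \<subseteq> inversions (letters \<nu>)" using inv less.prems by auto
      have "card (inversions (letters \<sigma>)) < card (inversions (letters \<sigma>'))" using inv' by simp
      moreover have "card (inversions (letters \<sigma>')) \<le> card (inversions (letters \<nu>))"
        using sub by (simp add: card_mono)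
      ultimately have "\<sigma>' \<le>\<^sub>P \<nu>" using sub \<sigma>'(2) less.prems by (intro less.hyps) auto
      moreover have "perm_cover \<sigma> \<sigma>'" using w \<sigma>' by (auto simp: perm_cover_def)
      ultimately show ?thesis by (simp add: perm_le_def converse_rtranclp_into_rtranclp)
    qed
  qed
qed

section \<open>Forced inversions and the Baxter order\<close>

text \<open>Being last in \<open>w\<close> among the letters of an interval is leading in \<open>rev w\<close>.\<close>

definition forced_le :: "nat list \<Rightarrow> nat list \<Rightarrow> bool"
  where "forced_le w w' \<longleftrightarrow> (\<forall>a b. a < b \<longrightarrow>
    (leads w b a \<longrightarrow> leads w' b a) \<and> (leads (rev w) a b \<longrightarrow> leads (rev w') a b))"

text \<open>A forced inversion is a family of inversions sharing the letter \<open>b\<close> or the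
  letter \<open>a\<close>, so it survives when inversions are added.\<close>

lemma forced_le_if_inversions:
  assumes "set w = set w'" "inversions w \<subseteq> inversions w'"
  shows "forced_le w w'"
  unfolding forced_le_def
proof (intro allI impI conjI)
  fix a b :: nat
  assume ab: "a < b"
  have sub: "before w' y x" if "x < y" "before w y x" for x y
    using that assms(2) by (auto simp: inversions_def)
  show "leads w' b a" if "leads w b a"
    using that ab assms(1) by (auto simp: leads_def intro!: sub)
  show "leads (rev w') a b" if "leads (rev w) a b"
    using that ab assms(1) by (auto simp: leads_def before_rev intro!: sub)
qed

text \<open>A discrete intermediate value argument.\<close>

lemma crossing:
  assumes "Q x" "\<not> Q y"
  shows "\<exists>u p q v. x # m @ [y] = u @ p # q # v \<and> Q p \<and> \<not> Q q"
  using assms(1)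
proof (induction m arbitrary: x)
  case Nil
  have "x # [] @ [y] = [] @ x # y # []" by simp
  with Nil assms(2) show ?case by blast
next
  case (Cons z m)
  show ?case
  proof (cases "Q z")
    case True
    with Cons.IH obtain u p q v where "z # m @ [y] = u @ p # q # v" "Q p" "\<not> Q q" by blast
    then have "x # (z # m) @ [y] = (x # u) @ p # q # v" by simp
    with \<open>Q p\<close> \<open>\<not> Q q\<close> show ?thesis by blast
  next
    case False
    have "x # (z # m) @ [y] = [] @ x # z # m @ [y]" by simp
    with Cons.prems False show ?thesis by blast
  qed
qed

text \<open>If no letter between \<open>b\<close> and \<open>a\<close> in \<open>w\<close> has an intermediate value, then somewhere between them
  \<open>w\<close> descends from at least \<open>b\<close> to at most \<open>a\<close>. Rigidity of that descent keeps all intermediate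
  values on one side of it, which makes \<open>(b, a)\<close> itself a forced inversion.\<close>

lemma forced_inversions_generate:
  assumes w: "distinct w" and w': "distinct w'" and le: "forced_le w w'"
    and rigid: "\<And>u a b v z z'. w = u @ b # a # v \<Longrightarrow> a < z \<Longrightarrow> z < b \<Longrightarrow> z \<in> set u \<Longrightarrow>
      a < z' \<Longrightarrow> z' < b \<Longrightarrow> z' \<in> set v \<Longrightarrow> False"
  shows "w = u @ b # m @ a # v \<Longrightarrow> a < b \<Longrightarrow> before w' b a"
proof (induction "length m" arbitrary: u b m a v rule: less_induct)
  case less
  show ?case
  proof (cases "\<exists>x \<in> set m. a < x \<and> x < b")
    case True
    \<comment> \<open>An intermediate letter splits the inversion into two with shorter gaps, which
      transitivity rejoins.\<close>
    then obtain x m\<^sub>1 m\<^sub>2 where x: "a < x" "x < b" and m: "m = m\<^sub>1 @ x # m\<^sub>2"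
      by (metis split_list)
    have "before w' b x" using less.hyps[of m\<^sub>1 u b x "m\<^sub>2 @ a # v"] less.prems x m by simp
    moreover have "before w' x a" using less.hyps[of m\<^sub>2 "u @ b # m\<^sub>1" x a v] less.prems x m by simp
    ultimately show ?thesis using before_trans[OF w'] by blast
  next
    case False
    have "\<not> ((\<exists>z \<in> set u. a < z \<and> z < b) \<and> (\<exists>z \<in> set v. a < z \<and> z < b))"
    proof
      assume "(\<exists>z \<in> set u. a < z \<and> z < b) \<and> (\<exists>z \<in> set v. a < z \<and> z < b)"
      then obtain z z' where z: "z \<in> set u" "a < z" "z < b" and z': "z' \<in> set v" "a < z'" "z' < b"
        by blast
      obtain u\<^sub>1 p q v\<^sub>1 where pq: "b # m @ [a] = u\<^sub>1 @ p # q # v\<^sub>1" "b \<le> p" "\<not> b \<le> q"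
        using crossing[of "\<lambda>x. b \<le> x" b a m] less.prems by auto
      then have "q \<in> set (b # m @ [a])" by simp
      then have "q \<le> a" using False pq(3) by auto
      have "b # m @ a # v = (b # m @ [a]) @ v" by simp
      then have "w = (u @ u\<^sub>1) @ p # q # (v\<^sub>1 @ v)" using less.prems(1) pq(1) by simp
      then show False
        by (rule rigid[of _ p q _ z z']) (use z z' pq \<open>q \<le> a\<close> in auto)
    qed
    \<comment> \<open>With no intermediate value in \<open>u\<close> or \<open>m\<close>, the letter
      \<open>b\<close> is first among the values from \<open>a\<close> to \<open>b\<close>; with
      none in \<open>m\<close> or \<open>v\<close>, the letter \<open>a\<close> is last among
      them.\<close>
    then have "leads w b a \<or> leads (rev w) a b"
      using less.prems w False by (fastforce simp: leads_def before_rev before_append)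
    then show ?thesis using le less.prems(2)
      by (auto simp: forced_le_def leads_def before_rev)
  qed
qed

text \<open>Forced inversions depend on the pair of trees alone, so any permutation of a fibre may
  be used to compute them.\<close>

lemma leads_cong_P_symbol:
  assumes "P_symbol \<sigma> = P_symbol \<nu>"
  shows "leads (letters \<sigma>) x y \<longleftrightarrow> leads (letters \<nu>) x y"
    and "leads (rev (letters \<sigma>)) x y \<longleftrightarrow> leads (rev (letters \<nu>)) x y"
proof -
  have "psize \<sigma> = psize \<nu>" using assms size_P_symbol(1) by metis
  then have "set (letters \<sigma>) = set (letters \<nu>)" by (simp add: set_letters)
  then show "leads (letters \<sigma>) x y \<longleftrightarrow> leads (letters \<nu>) x y"
    "leads (rev (letters \<sigma>)) x y \<longleftrightarrow> leads (rev (letters \<nu>)) x y"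
    using assms leads_cong_bst[of "letters \<sigma>" "letters \<nu>"]
      leads_cong_bst[of "rev (letters \<sigma>)" "rev (letters \<nu>)"]
    by (simp_all add: P_symbol_bst distinct_letters)
qed

text \<open>From left to right, comparable representatives have the same forced inversions as
  \<sigma> and \<nu>. From right to left, only \<sigma> is replaced, by a permutation of its fibre
  with fewest inversions, which then lies below \<nu> itself.\<close>

lemma baxter_le_iff_forced:
  "P_symbol \<sigma> \<le>\<^sub>B P_symbol \<nu> \<longleftrightarrow> psize \<sigma> = psize \<nu> \<and> forced_le (letters \<sigma>) (letters \<nu>)"
proof
  assume "P_symbol \<sigma> \<le>\<^sub>B P_symbol \<nu>"
  then obtain \<sigma>' \<nu>' where le: "\<sigma>' \<le>\<^sub>P \<nu>'" and eq: "P_symbol \<sigma>' = P_symbol \<sigma>" "P_symbol \<nu>' = P_symbol \<nu>"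
    by (auto simp: baxter_le_def)
  have "psize \<sigma>' = psize \<sigma>" "psize \<nu>' = psize \<nu>" using eq size_P_symbol(1) by metis+
  moreover have "forced_le (letters \<sigma>') (letters \<nu>')"
    using le by (intro forced_le_if_inversions) (auto simp: perm_le_iff_inversions set_letters)
  then have "forced_le (letters \<sigma>) (letters \<nu>)"
    by (simp add: forced_le_def leads_cong_P_symbol[OF eq(1)] leads_cong_P_symbol[OF eq(2)])
  ultimately show "psize \<sigma> = psize \<nu> \<and> forced_le (letters \<sigma>) (letters \<nu>)"
    using psize_perm_le[OF le] by simp
next
  assume asm: "psize \<sigma> = psize \<nu> \<and> forced_le (letters \<sigma>) (letters \<nu>)"
  obtain \<mu> where \<mu>: "P_symbol \<mu> = P_symbol \<sigma>"
    and least: "\<And>\<tau>. P_symbol \<tau> = P_symbol \<sigma> \<Longrightarrow>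
      card (inversions (letters \<mu>)) \<le> card (inversions (letters \<tau>))"
    using ex_has_least_nat[of "\<lambda>\<tau>. P_symbol \<tau> = P_symbol \<sigma>" \<sigma> "\<lambda>\<tau>. card (inversions (letters \<tau>))"]
    by blast
  have psize: "psize \<mu> = psize \<nu>" using \<mu> size_P_symbol(1) asm by metis
  have forced: "forced_le (letters \<mu>) (letters \<nu>)"
    using asm by (simp add: forced_le_def leads_cong_P_symbol[OF \<mu>])
  \<comment> \<open>Undoing such a descent removes an inversion yet keeps both trees:
    \<open>z\<close> before it protects the left tree, \<open>z'\<close> after it the right
    one.\<close>
  have rigid: False
    if w: "letters \<mu> = u @ b # a # v" and z: "a < z" "z < b" "z \<in> set u"
      and z': "a < z'" "z' < b" "z' \<in> set v" for u a b v z z'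
  proof -
    have d: "distinct (u @ a # b # v)" using distinct_letters[of \<mu>] w by auto
    have "set (u @ a # b # v) = {1..psize \<mu>}" using set_letters[of \<mu>] w by auto
    with d obtain \<tau> where \<tau>: "letters \<tau> = u @ a # b # v" by (rule perm_word_exists)
    have "bst_shape (letters \<tau>) = bst_shape (letters \<mu>)"
      unfolding \<tau> w by (rule bst_swap) (use z in auto)
    moreover have "bst_shape (rev v @ b # a # rev u) = bst_shape (rev v @ a # b # rev u)"
      by (rule bst_swap) (use z' in auto)
    then have "bst_shape (rev (letters \<tau>)) = bst_shape (rev (letters \<mu>))" by (simp add: \<tau> w)
    ultimately have "P_symbol \<tau> = P_symbol \<sigma>" using \<mu> by (simp add: P_symbol_bst)
    moreover have "card (inversions (letters \<tau>)) < card (inversions (letters \<mu>))"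
      unfolding \<tau> w using inversions_swap[OF d] z by simp
    ultimately show False using least by (metis not_le)
  qed
  have "before (letters \<nu>) b a" if "a < b" "before (letters \<mu>) b a" for a b
  proof -
    from before_split[OF that(2)] obtain u m v where "letters \<mu> = u @ b # m @ a # v" by blast
    from forced_inversions_generate[OF distinct_letters distinct_letters forced _ this \<open>a < b\<close>]
    show ?thesis using rigid by blast
  qed
  then have "inversions (letters \<mu>) \<subseteq> inversions (letters \<nu>)" by (auto simp: inversions_def)
  then have "\<mu> \<le>\<^sub>P \<nu>" using psize by (simp add: perm_le_iff_inversions)
  with \<mu> show "P_symbol \<sigma> \<le>\<^sub>B P_symbol \<nu>" by (auto simp: baxter_le_def)
qed

section \<open>Shuffles and grafting\<close>

lemma leads_filter_iff:
  assumes "\<And>x y z. I x \<Longrightarrow> I y \<Longrightarrow> z \<in> {min x y..max x y} \<Longrightarrow> I z"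
  shows "leads (filter I w) x y \<longleftrightarrow> leads w x y \<and> I x \<and> I y"
proof (cases "I x \<and> I y")
  case True
  then have "leads (filter I w) x y \<longleftrightarrow> leads w x y"
    by (intro leads_filter) (use assms[of x y] in blast)
  with True show ?thesis by simp
next
  case False
  then show ?thesis using leads_in_set[of "filter I w" x y] by auto
qed

lemma leads_low_iff: "leads (filter (\<lambda>x. x \<le> k) w) x y \<longleftrightarrow> leads w x y \<and> x \<le> k \<and> y \<le> k"
  by (rule leads_filter_iff) (auto simp: min_def max_def split: if_splits)

lemma leads_high_iff: "leads (filter (\<lambda>x. \<not> x \<le> k) w) x y \<longleftrightarrow> leads w x y \<and> \<not> x \<le> k \<and> \<not> y \<le> k"
  by (rule leads_filter_iff) (auto simp: min_def max_def split: if_splits)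

text \<open>Intervals with both ends on one side of \<open>k\<close> stay there, so the filtered
  words see all forced inversions within a part; only those across \<open>k\<close> must be compared
  in the full words.\<close>

lemma forced_le_split:
  "forced_le w w' \<longleftrightarrow>
    forced_le (filter (\<lambda>x. x \<le> k) w) (filter (\<lambda>x. x \<le> k) w') \<and>
    forced_le (filter (\<lambda>x. \<not> x \<le> k) w) (filter (\<lambda>x. \<not> x \<le> k) w') \<and>
    (\<forall>a b. a \<le> k \<longrightarrow> k < b \<longrightarrow>
      (leads w b a \<longrightarrow> leads w' b a) \<and> (leads (rev w) a b \<longrightarrow> leads (rev w') a b))"
    (is "_ \<longleftrightarrow> ?low \<and> ?high \<and> ?cross")
proof
  assume le: "forced_le w w'"
  then have ?low ?high
    unfolding forced_le_def rev_filter leads_low_iff leads_high_iff by blast+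
  moreover have ?cross
  proof (intro allI impI)
    fix a b :: nat
    assume "a \<le> k" "k < b"
    then have "a < b" by simp
    with le show "(leads w b a \<longrightarrow> leads w' b a) \<and> (leads (rev w) a b \<longrightarrow> leads (rev w') a b)"
      unfolding forced_le_def by blast
  qed
  ultimately show "?low \<and> ?high \<and> ?cross" by blast
next
  assume R: "?low \<and> ?high \<and> ?cross"
  show "forced_le w w'"
    unfolding forced_le_def
  proof (intro allI impI)
    fix a b :: nat
    assume ab: "a < b"
    then consider "a \<le> k \<and> b \<le> k" | "\<not> a \<le> k \<and> \<not> b \<le> k" | "a \<le> k \<and> k < b" by linarith
    then show "(leads w b a \<longrightarrow> leads w' b a) \<and> (leads (rev w) a b \<longrightarrow> leads (rev w') a b)"
      using R ab unfolding forced_le_def rev_filter leads_low_iff leads_high_iff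
      by cases blast+
  qed
qed

lemma not_leads_behind:
  "distinct (u @ v) \<Longrightarrow> y \<in> set u \<Longrightarrow> x \<in> set v \<Longrightarrow> \<not> leads (u @ v) x y"
proof
  assume d: "distinct (u @ v)" and mem: "y \<in> set u" "x \<in> set v" and l: "leads (u @ v) x y"
  have "before (u @ v) y x" using mem by (simp add: before_append)
  moreover have "y \<noteq> x" using d mem by auto
  then have "before (u @ v) x y" using l by (auto simp: leads_def)
  ultimately show False using before_antisym[OF d] by blast
qed

text \<open>Letters of \<open>v\<close> come after \<open>x\<close> automatically. An intermediate
  letter \<open>z\<close> of \<open>u\<close> is also led by \<open>x\<close> in \<open>w\<close>,
  its interval being smaller, and the last hypothesis carries this over to \<open>u\<close>.\<close>

lemma leads_append_cross:
  assumes "leads w x y" "set w = set u \<union> set v" "x \<in> set u" "y \<in> set v"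
    and "\<And>z. z \<in> set u \<Longrightarrow> z \<in> {min x y..max x y} \<Longrightarrow> z \<noteq> x \<Longrightarrow> leads w x z \<Longrightarrow> leads u x z"
  shows "leads (u @ v) x y"
proof -
  have "before (u @ v) x z" if z: "z \<in> set u \<union> set v" "z \<in> {min x y..max x y}" "z \<noteq> x" for z
  proof (cases "z \<in> set u")
    case True
    have "{min x z..max x z} \<subseteq> {min x y..max x y}" using z(2) by (auto simp: min_def max_def split: if_splits)
    then have "leads w x z" using assms(1) z assms(2) unfolding leads_def by blast
    with assms(5) True z(2,3) have "leads u x z" by blast
    then have "before u x z" using z(3) by (simp add: leads_def)
    then show ?thesis by (simp add: before_append)
  next
    case False
    then show ?thesis using z(1) assms(3) by (simp add: before_append)
  qed
  then show ?thesis using assms(3,4) by (simp add: leads_def)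
qed

lemma forced_le_shift:
  "forced_le (map (\<lambda>x. x + n) w) (map (\<lambda>x. x + n) w') \<longleftrightarrow> forced_le w w'"
proof
  assume le: "forced_le (map (\<lambda>x. x + n) w) (map (\<lambda>x. x + n) w')"
  show "forced_le w w'"
    unfolding forced_le_def
  proof (intro allI impI)
    fix a b :: nat
    assume "a < b"
    then have "a + n < b + n" by simp
    with le have "(leads (map (\<lambda>x. x + n) w) (b + n) (a + n) \<longrightarrow> leads (map (\<lambda>x. x + n) w') (b + n) (a + n)) \<and>
      (leads (map (\<lambda>x. x + n) (rev w)) (a + n) (b + n) \<longrightarrow> leads (map (\<lambda>x. x + n) (rev w')) (a + n) (b + n))"
      unfolding forced_le_def rev_map by blast
    then show "(leads w b a \<longrightarrow> leads w' b a) \<and> (leads (rev w) a b \<longrightarrow> leads (rev w') a b)"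
      unfolding leads_shift .
  qed
next
  assume le: "forced_le w w'"
  show "forced_le (map (\<lambda>x. x + n) w) (map (\<lambda>x. x + n) w')"
    unfolding forced_le_def rev_map
  proof (intro allI impI conjI)
    fix a b :: nat
    assume ab: "a < b"
    show "leads (map (\<lambda>x. x + n) w') b a" if l: "leads (map (\<lambda>x. x + n) w) b a"
    proof -
      from leads_in_set[OF l] obtain a' b' where "a = a' + n" "b = b' + n" by auto
      with l ab le show ?thesis by (simp add: leads_shift forced_le_def)
    qed
    show "leads (map (\<lambda>x. x + n) (rev w')) a b" if l: "leads (map (\<lambda>x. x + n) (rev w)) a b"
    proof -
      from leads_in_set[OF l] obtain a' b' where "a = a' + n" "b = b' + n" by auto
      with l ab le show ?thesis by (simp add: leads_shift forced_le_def)
    qed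
  qed
qed

text \<open>In \<open>u @ v\<close> every small letter precedes every large one, so the crossing
  condition is vacuous.\<close>

lemma forced_le_concat:
  assumes "distinct (u @ v)" "\<forall>x \<in> set u. x \<le> k" "\<forall>x \<in> set v. \<not> x \<le> k"
  shows "forced_le (u @ v) w \<longleftrightarrow>
    forced_le u (filter (\<lambda>x. x \<le> k) w) \<and> forced_le v (filter (\<lambda>x. \<not> x \<le> k) w)"
proof -
  have filters: "filter (\<lambda>x. x \<le> k) (u @ v) = u" "filter (\<lambda>x. \<not> x \<le> k) (u @ v) = v"
    using assms(2,3) by (simp_all add: filter_id_conv filter_empty_conv)
  have "\<not> leads (u @ v) b a \<and> \<not> leads (rev (u @ v)) a b" if "a \<le> k" "k < b" for a b
  proof -
    have "a \<notin> set v" "b \<notin> set u" using that assms(2,3) by auto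
    then show ?thesis
      using not_leads_behind[OF assms(1), of a b] not_leads_behind[of "rev v" "rev u" b a] assms(1)
        leads_in_set[of "u @ v" b a] leads_in_set[of "rev (u @ v)" a b] by auto
  qed
  then show ?thesis unfolding forced_le_split[of "u @ v" w k] filters by blast
qed

text \<open>In \<open>v @ u\<close> every large \<open>b\<close> precedes every small
  \<open>a\<close>. If \<open>w\<close> forces this inversion by \<open>b\<close> being first, then
  \<open>b\<close> is also first in \<open>v\<close> among the intermediate large letters, by
  comparison of the large parts. Dually for \<open>a\<close> being last, with the small
  parts.\<close>

lemma forced_le_concat_rev:
  assumes "set w = set u \<union> set v" "\<forall>x \<in> set u. x \<le> k" "\<forall>x \<in> set v. \<not> x \<le> k"
  shows "forced_le w (v @ u) \<longleftrightarrow>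
    forced_le (filter (\<lambda>x. x \<le> k) w) u \<and> forced_le (filter (\<lambda>x. \<not> x \<le> k) w) v"
proof -
  have filters: "filter (\<lambda>x. x \<le> k) (v @ u) = u" "filter (\<lambda>x. \<not> x \<le> k) (v @ u) = v"
    using assms(2,3) by (simp_all add: filter_id_conv filter_empty_conv)
  have "(leads w b a \<longrightarrow> leads (v @ u) b a) \<and> (leads (rev w) a b \<longrightarrow> leads (rev (v @ u)) a b)"
    if low: "forced_le (filter (\<lambda>x. x \<le> k) w) u" and high: "forced_le (filter (\<lambda>x. \<not> x \<le> k) w) v"
      and ab: "a \<le> k" "k < b" for a b
  proof (intro conjI impI)
    assume l: "leads w b a"
    then have mem: "a \<in> set u" "b \<in> set v" using leads_in_set[OF l] assms ab by auto
    show "leads (v @ u) b a"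
    proof (rule leads_append_cross[OF l _ mem(2,1)])
      fix z assume z: "z \<in> set v" "z \<in> {min b a..max b a}" "z \<noteq> b" "leads w b z"
      then have "z < b" using ab by simp
      then show "leads v b z"
        using high z assms(3) mem(2) unfolding forced_le_def leads_high_iff by blast
    qed (use assms(1) in auto)
  next
    assume l: "leads (rev w) a b"
    then have mem: "a \<in> set u" "b \<in> set v" using leads_in_set[OF l] assms ab by auto
    have "leads (rev u @ rev v) a b"
    proof (rule leads_append_cross[OF l])
      fix z assume z: "z \<in> set (rev u)" "z \<in> {min a b..max a b}" "z \<noteq> a" "leads (rev w) a z"
      then have "a < z" using ab by simp
      then show "leads (rev u) a z"
        using low z assms(2) mem(1) unfolding forced_le_def rev_filter leads_low_iff by simp
    qed (use assms(1) mem in auto)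
    then show "leads (rev (v @ u)) a b" by simp
  qed
  then show ?thesis unfolding forced_le_split[of w "v @ u" k] filters by blast
qed

section \<open>Concatenations and shuffles of permutations\<close>

lemma letters_bounds:
  "\<forall>x \<in> set (letters \<sigma>). x \<le> psize \<sigma>"
  "\<forall>x \<in> set (map (\<lambda>x. x + psize \<sigma>) (letters \<nu>)). \<not> x \<le> psize \<sigma>"
  by (auto simp: set_letters)

lemma set_shifted_letters:
  "set (map (\<lambda>x. x + k) (letters \<nu>)) = {Suc k..k + psize \<nu>}"
proof -
  have "(\<lambda>x. x + k) ` {1..psize \<nu>} = {1 + k..psize \<nu> + k}" by (rule image_add_atLeastAtMost')
  then show ?thesis by (simp only: set_map set_letters) (simp add: add.commute)
qed

lemma concat_perms_exist:
  shows "\<exists>\<tau>. letters \<tau> = letters \<sigma> @ map (\<lambda>x. x + psize \<sigma>) (letters \<nu>)"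
    and "\<exists>\<tau>. letters \<tau> = map (\<lambda>x. x + psize \<sigma>) (letters \<nu>) @ letters \<sigma>"
proof -
  let ?u = "letters \<sigma>" and ?v = "map (\<lambda>x. x + psize \<sigma>) (letters \<nu>)"
  have sets: "set ?u = {1..psize \<sigma>}" "set ?v = {Suc (psize \<sigma>)..psize \<sigma> + psize \<nu>}"
    by (rule set_letters, rule set_shifted_letters)
  have "distinct ?u" "distinct ?v" by (simp_all add: distinct_letters distinct_map)
  moreover have "set ?u \<inter> set ?v = {}" "set ?u \<union> set ?v = {1..psize \<sigma> + psize \<nu>}"
    unfolding sets by (auto simp del: One_nat_def)
  ultimately have "distinct (?u @ ?v)" "set (?u @ ?v) = {1..psize \<sigma> + psize \<nu>}"
    "distinct (?v @ ?u)" "set (?v @ ?u) = {1..psize \<sigma> + psize \<nu>}" by auto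
  then show "\<exists>\<tau>. letters \<tau> = ?u @ ?v" "\<exists>\<tau>. letters \<tau> = ?v @ ?u"
    by (metis perm_word_exists)+
qed

text \<open>Small letters come first in the word but last in its reversal, which is why the left
  trees are grafted on the right spine and the right trees on the left spine.\<close>

lemma P_symbol_concat:
  assumes "letters \<tau> = letters \<sigma> @ map (\<lambda>x. x + psize \<sigma>) (letters \<nu>)"
  shows "P_symbol \<tau> = pair_over (P_symbol \<sigma>) (P_symbol \<nu>)"
proof -
  let ?v = "map (\<lambda>x. x + psize \<sigma>) (letters \<nu>)"
  have lt: "\<forall>x \<in> set (letters \<sigma>). \<forall>y \<in> set ?v. x < y" by (auto simp: set_letters)
  have "bst_shape (rev ?v @ rev (letters \<sigma>)) =
      tree_over (bst_shape (rev (letters \<sigma>))) (bst_shape (rev ?v))"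
    by (rule bst_append_over) (use lt in simp)
  with bst_append_under[OF lt] assms show ?thesis
    by (simp add: P_symbol_bst pair_over_def bst_shift rev_map)
qed

lemma P_symbol_concat_rev:
  assumes "letters \<tau> = map (\<lambda>x. x + psize \<sigma>) (letters \<nu>) @ letters \<sigma>"
  shows "P_symbol \<tau> = pair_under (P_symbol \<sigma>) (P_symbol \<nu>)"
proof -
  let ?v = "map (\<lambda>x. x + psize \<sigma>) (letters \<nu>)"
  have lt: "\<forall>x \<in> set (letters \<sigma>). \<forall>y \<in> set ?v. x < y" by (auto simp: set_letters)
  have "bst_shape (rev (letters \<sigma>) @ rev ?v) =
      tree_under (bst_shape (rev (letters \<sigma>))) (bst_shape (rev ?v))"
    by (rule bst_append_under) (use lt in simp)
  with bst_append_over[OF lt] assms show ?thesis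
    by (simp add: P_symbol_bst pair_under_def bst_shift rev_map)
qed

text \<open>Separating the two alphabets inverts shuffling. Membership becomes two equations on
  restrictions, the form in which \<open>forced_le_split\<close> can be applied.\<close>

lemma in_shifted_shuffles_iff:
  "\<pi> \<in> shifted_shuffles \<sigma> \<nu> \<longleftrightarrow>
    filter (\<lambda>x. x \<le> psize \<sigma>) (letters \<pi>) = letters \<sigma> \<and>
    filter (\<lambda>x. \<not> x \<le> psize \<sigma>) (letters \<pi>) = map (\<lambda>x. x + psize \<sigma>) (letters \<nu>)"
proof -
  let ?v = "map (\<lambda>x. x + psize \<sigma>) (letters \<nu>)"
  have "partition (\<lambda>x. x \<le> psize \<sigma>) -` {(letters \<sigma>, ?v)} = shuffles (letters \<sigma>) ?v"
    by (rule inv_image_partition) (use letters_bounds(1)[of \<sigma>] letters_bounds(2)[of \<sigma> \<nu>] in blast)+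
  then show ?thesis by (auto simp: shifted_shuffles_def o_def)
qed

lemma psize_shifted_shuffle: "\<pi> \<in> shifted_shuffles \<sigma> \<nu> \<Longrightarrow> psize \<pi> = psize \<sigma> + psize \<nu>"
  by (auto simp: shifted_shuffles_def dest: length_shuffles)

lemma unshuffle:
  assumes "k \<le> psize \<pi>"
  obtains \<sigma> \<nu> where "psize \<sigma> = k" "\<pi> \<in> shifted_shuffles \<sigma> \<nu>"
proof -
  let ?w = "letters \<pi>"
  have "distinct (filter (\<lambda>x. x \<le> k) ?w)" "set (filter (\<lambda>x. x \<le> k) ?w) = {1..k}"
    using assms by (auto simp: distinct_letters set_letters simp del: One_nat_def)
  then obtain \<sigma> where \<sigma>: "letters \<sigma> = filter (\<lambda>x. x \<le> k) ?w" "psize \<sigma> = k" by (rule perm_word_exists)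
  let ?h = "filter (\<lambda>x. \<not> x \<le> k) ?w"
  have sh: "set ?h = {Suc k..psize \<pi>}" by (auto simp: set_letters)
  have "inj_on (\<lambda>x. x - k) (set ?h)" unfolding sh by (auto simp: inj_on_def)
  then have "distinct (map (\<lambda>x. x - k) ?h)" by (simp add: distinct_map distinct_letters)
  moreover have "(\<lambda>x. x - k) ` {Suc k..psize \<pi>} = {1..psize \<pi> - k}"
  proof (rule set_eqI)
    show "x \<in> (\<lambda>x. x - k) ` {Suc k..psize \<pi>} \<longleftrightarrow> x \<in> {1..psize \<pi> - k}" for x
      by (auto simp: image_iff intro!: bexI[of _ "x + k"])
  qed
  then have "set (map (\<lambda>x. x - k) ?h) = {1..psize \<pi> - k}" by (simp only: set_map sh)
  ultimately obtain \<nu> where \<nu>: "letters \<nu> = map (\<lambda>x. x - k) ?h" by (rule perm_word_exists)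
  have "map (\<lambda>x. x + k) (letters \<nu>) = ?h"
    unfolding \<nu> map_map by (rule map_idI) simp
  with \<sigma> have "\<pi> \<in> shifted_shuffles \<sigma> \<nu>" by (simp add: in_shifted_shuffles_iff)
  with \<sigma>(2) show thesis by (rule that)
qed

section \<open>Factors of a realized grafting\<close>

lemma size_tree_over: "size (tree_over s t) = size s + size t"
  by (induction t) auto

lemma size_tree_under: "size (tree_under s t) = size s + size t"
  by (induction s) auto

lemma P_symbol_restrict:
  assumes "bst_shape (filter (\<lambda>x. x \<le> k) (letters \<tau>)) = fst J\<^sub>0 \<and>
      bst_shape (filter (\<lambda>x. \<not> x \<le> k) (letters \<tau>)) = fst J\<^sub>1"
    and "bst_shape (filter (\<lambda>x. x \<le> k) (rev (letters \<tau>))) = snd J\<^sub>0 \<and>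
      bst_shape (filter (\<lambda>x. \<not> x \<le> k) (rev (letters \<tau>))) = snd J\<^sub>1"
    and "psize \<sigma> = k" "\<tau> \<in> shifted_shuffles \<sigma> \<nu>"
  shows "P_symbol \<sigma> = J\<^sub>0" "P_symbol \<nu> = J\<^sub>1"
proof -
  have "filter (\<lambda>x. x \<le> k) (letters \<tau>) = letters \<sigma>"
    "filter (\<lambda>x. \<not> x \<le> k) (letters \<tau>) = map (\<lambda>x. x + k) (letters \<nu>)"
    using assms(3,4) by (simp_all add: in_shifted_shuffles_iff)
  then show "P_symbol \<sigma> = J\<^sub>0" "P_symbol \<nu> = J\<^sub>1"
    using assms(1,2) unfolding P_symbol_bst rev_filter [symmetric]
    by (simp_all add: prod_eq_iff bst_shift rev_map)
qed

lemma length_filter_low: "k \<le> psize \<tau> \<Longrightarrow> length (filter (\<lambda>x. x \<le> k) (letters \<tau>)) = k"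
  by (metis unshuffle in_shifted_shuffles_iff)

text \<open>This takes the place of surjectivity of \<open>P_symbol\<close> onto twin pairs: a
  permutation realizing the grafting is cut by value at the size of \<open>J\<^sub>0\<close>, and
  its two parts realize the factors.\<close>

lemma pair_over_factors:
  assumes "twin_pair J\<^sub>0" "P_symbol \<tau> = pair_over J\<^sub>0 J\<^sub>1"
  obtains \<sigma> \<nu> where "P_symbol \<sigma> = J\<^sub>0" "P_symbol \<nu> = J\<^sub>1"
proof -
  let ?k = "size (fst J\<^sub>0)"
  have "psize \<tau> = ?k + size (fst J\<^sub>1)"
    using size_P_symbol(1)[of \<tau>] assms(2) by (simp add: pair_over_def size_tree_under)
  then have k: "?k \<le> psize \<tau>" by simp
  \<comment> \<open>Twin trees have equal size, so one threshold cuts both the word and its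
    reversal.\<close>
  have len: "length (filter (\<lambda>x. x \<le> ?k) (letters \<tau>)) = ?k"
    "length (filter (\<lambda>x. x \<le> ?k) (rev (letters \<tau>))) = size (snd J\<^sub>0)"
    using length_filter_low[OF k] assms(1) by (simp_all add: twin_pair_def flip: rev_filter)
  have eq: "bst_shape (letters \<tau>) = tree_under (fst J\<^sub>0) (fst J\<^sub>1)"
    "bst_shape (rev (letters \<tau>)) = tree_over (snd J\<^sub>0) (snd J\<^sub>1)"
    using assms(2) by (simp_all add: P_symbol_bst pair_over_def)
  obtain \<sigma> \<nu> where "psize \<sigma> = ?k" "\<tau> \<in> shifted_shuffles \<sigma> \<nu>" using unshuffle[OF k] .
  from P_symbol_restrict[OF bst_under_split[OF eq(1) distinct_letters len(1)]
      bst_over_split[OF eq(2) _ len(2)] this]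
  show thesis by (intro that) (simp_all add: distinct_letters)
qed

lemma pair_under_factors:
  assumes "twin_pair J\<^sub>0" "P_symbol \<tau> = pair_under J\<^sub>0 J\<^sub>1"
  obtains \<sigma> \<nu> where "P_symbol \<sigma> = J\<^sub>0" "P_symbol \<nu> = J\<^sub>1"
proof -
  let ?k = "size (fst J\<^sub>0)"
  have "psize \<tau> = ?k + size (fst J\<^sub>1)"
    using size_P_symbol(1)[of \<tau>] assms(2) by (simp add: pair_under_def size_tree_over)
  then have k: "?k \<le> psize \<tau>" by simp
  have len: "length (filter (\<lambda>x. x \<le> ?k) (letters \<tau>)) = ?k"
    "length (filter (\<lambda>x. x \<le> ?k) (rev (letters \<tau>))) = size (snd J\<^sub>0)"
    using length_filter_low[OF k] assms(1) by (simp_all add: twin_pair_def flip: rev_filter)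
  have eq: "bst_shape (letters \<tau>) = tree_over (fst J\<^sub>0) (fst J\<^sub>1)"
    "bst_shape (rev (letters \<tau>)) = tree_under (snd J\<^sub>0) (snd J\<^sub>1)"
    using assms(2) by (simp_all add: P_symbol_bst pair_under_def)
  obtain \<sigma> \<nu> where "psize \<sigma> = ?k" "\<tau> \<in> shifted_shuffles \<sigma> \<nu>" using unshuffle[OF k] .
  from P_symbol_restrict[OF bst_over_split[OF eq(1) distinct_letters len(1)]
      bst_under_split[OF eq(2) _ len(2)] this]
  show thesis by (intro that) (simp_all add: distinct_letters)
qed

lemma psize_eq_if_baxter_le: "P_symbol \<sigma> \<le>\<^sub>B P_symbol \<nu> \<Longrightarrow> psize \<sigma> = psize \<nu>"
  by (simp add: baxter_le_iff_forced)

section \<open>Up-sets and down-sets of graftings as sets of shuffles\<close>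

text \<open>The concatenation \<tau> represents the grafting. Equal sizes of
  \<open>\<sigma>\<^sub>0\<close> and \<sigma> make the threshold of \<tau> the one at which \<pi>
  unshuffles.\<close>

lemma baxter_le_shuffle_over:
  assumes "psize \<sigma>\<^sub>0 = psize \<sigma>" "\<pi> \<in> shifted_shuffles \<sigma> \<nu>"
  shows "pair_over (P_symbol \<sigma>\<^sub>0) (P_symbol \<nu>\<^sub>0) \<le>\<^sub>B P_symbol \<pi> \<longleftrightarrow>
    P_symbol \<sigma>\<^sub>0 \<le>\<^sub>B P_symbol \<sigma> \<and> P_symbol \<nu>\<^sub>0 \<le>\<^sub>B P_symbol \<nu>"
proof -
  obtain \<tau> where \<tau>: "letters \<tau> = letters \<sigma>\<^sub>0 @ map (\<lambda>x. x + psize \<sigma>\<^sub>0) (letters \<nu>\<^sub>0)"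
    using concat_perms_exist(1) by blast
  have "forced_le (letters \<tau>) (letters \<pi>) \<longleftrightarrow>
      forced_le (letters \<sigma>\<^sub>0) (letters \<sigma>) \<and> forced_le (letters \<nu>\<^sub>0) (letters \<nu>)"
    using forced_le_concat[of "letters \<sigma>\<^sub>0" "map (\<lambda>x. x + psize \<sigma>\<^sub>0) (letters \<nu>\<^sub>0)" "psize \<sigma>\<^sub>0" "letters \<pi>",
        OF _ letters_bounds] distinct_letters[of \<tau>] assms
    unfolding \<tau> in_shifted_shuffles_iff by (simp add: forced_le_shift)
  moreover have "psize \<tau> = psize \<sigma>\<^sub>0 + psize \<nu>\<^sub>0" by (simp add: \<tau>)
  ultimately show ?thesis
    unfolding P_symbol_concat[OF \<tau>, symmetric] baxter_le_iff_forced
    using assms(1) psize_shifted_shuffle[OF assms(2)] by auto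
qed

lemma baxter_le_shuffle_under:
  assumes "psize \<sigma>\<^sub>0 = psize \<sigma>" "\<pi> \<in> shifted_shuffles \<sigma> \<nu>"
  shows "P_symbol \<pi> \<le>\<^sub>B pair_under (P_symbol \<sigma>\<^sub>0) (P_symbol \<nu>\<^sub>0) \<longleftrightarrow>
    P_symbol \<sigma> \<le>\<^sub>B P_symbol \<sigma>\<^sub>0 \<and> P_symbol \<nu> \<le>\<^sub>B P_symbol \<nu>\<^sub>0"
proof -
  obtain \<tau> where \<tau>: "letters \<tau> = map (\<lambda>x. x + psize \<sigma>\<^sub>0) (letters \<nu>\<^sub>0) @ letters \<sigma>\<^sub>0"
    using concat_perms_exist(2) by blast
  have size: "psize \<tau> = psize \<sigma>\<^sub>0 + psize \<nu>\<^sub>0" by (simp add: \<tau>)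
  \<comment> \<open>Equal sizes provide the equal letter sets for
    \<open>forced_le_concat_rev\<close>; for unequal sizes both sides of the claim fail.\<close>
  have "forced_le (letters \<pi>) (letters \<tau>) \<longleftrightarrow>
      forced_le (letters \<sigma>) (letters \<sigma>\<^sub>0) \<and> forced_le (letters \<nu>) (letters \<nu>\<^sub>0)" if "psize \<pi> = psize \<tau>"
  proof -
    have "set (letters \<pi>) = set (letters \<tau>)" using that by (simp add: set_letters)
    then have "set (letters \<pi>) = set (letters \<sigma>\<^sub>0) \<union> set (map (\<lambda>x. x + psize \<sigma>\<^sub>0) (letters \<nu>\<^sub>0))"
      by (simp only: \<tau> set_append Un_commute)
    from forced_le_concat_rev[OF this letters_bounds] show ?thesis
      using assms unfolding \<tau> in_shifted_shuffles_iff by (simp add: forced_le_shift)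
  qed
  then show ?thesis
    unfolding P_symbol_concat_rev[OF \<tau>, symmetric] baxter_le_iff_forced
    using assms(1) psize_shifted_shuffle[OF assms(2)] size by auto
qed

text \<open>The product rule for \<open>E\<close> at the level of index sets.\<close>

lemma up_set_pair_over:
  assumes "twin_pair J\<^sub>0"
  shows "{\<pi>. pair_over J\<^sub>0 J\<^sub>1 \<le>\<^sub>B P_symbol \<pi>} =
    (\<Union>\<sigma> \<in> {\<sigma>. J\<^sub>0 \<le>\<^sub>B P_symbol \<sigma>}. \<Union>\<nu> \<in> {\<nu>. J\<^sub>1 \<le>\<^sub>B P_symbol \<nu>}. shifted_shuffles \<sigma> \<nu>)"
proof (intro equalityI subsetI)
  fix \<pi> assume "\<pi> \<in> {\<pi>. pair_over J\<^sub>0 J\<^sub>1 \<le>\<^sub>B P_symbol \<pi>}"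
  then have le: "pair_over J\<^sub>0 J\<^sub>1 \<le>\<^sub>B P_symbol \<pi>" by simp
  \<comment> \<open>A comparison with the grafting supplies a permutation realizing it, hence
    representatives of both factors.\<close>
  then obtain \<tau> where \<tau>: "P_symbol \<tau> = pair_over J\<^sub>0 J\<^sub>1" by (auto simp: baxter_le_def)
  then obtain \<sigma>\<^sub>0 \<nu>\<^sub>0 where J: "J\<^sub>0 = P_symbol \<sigma>\<^sub>0" "J\<^sub>1 = P_symbol \<nu>\<^sub>0"
    using pair_over_factors[OF assms] by metis
  have "psize \<tau> = psize \<pi>" using le \<tau> psize_eq_if_baxter_le by metis
  moreover have "psize \<tau> = psize \<sigma>\<^sub>0 + psize \<nu>\<^sub>0"
    using size_P_symbol(1)[of \<tau>] \<tau> by (simp add: J pair_over_def size_tree_under size_P_symbol)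
  ultimately have "psize \<sigma>\<^sub>0 \<le> psize \<pi>" by simp
  then obtain \<sigma> \<nu> where \<sigma>: "psize \<sigma> = psize \<sigma>\<^sub>0" "\<pi> \<in> shifted_shuffles \<sigma> \<nu>" by (rule unshuffle)
  with le show "\<pi> \<in> (\<Union>\<sigma> \<in> {\<sigma>. J\<^sub>0 \<le>\<^sub>B P_symbol \<sigma>}. \<Union>\<nu> \<in> {\<nu>. J\<^sub>1 \<le>\<^sub>B P_symbol \<nu>}. shifted_shuffles \<sigma> \<nu>)"
    using baxter_le_shuffle_over[OF \<sigma>(1)[symmetric] \<sigma>(2)] unfolding J by blast
next
  fix \<pi> assume "\<pi> \<in> (\<Union>\<sigma> \<in> {\<sigma>. J\<^sub>0 \<le>\<^sub>B P_symbol \<sigma>}. \<Union>\<nu> \<in> {\<nu>. J\<^sub>1 \<le>\<^sub>B P_symbol \<nu>}. shifted_shuffles \<sigma> \<nu>)"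
  then obtain \<sigma> \<nu> where le: "J\<^sub>0 \<le>\<^sub>B P_symbol \<sigma>" "J\<^sub>1 \<le>\<^sub>B P_symbol \<nu>"
    and \<pi>: "\<pi> \<in> shifted_shuffles \<sigma> \<nu>" by blast
  then obtain \<sigma>\<^sub>0 \<nu>\<^sub>0 where J: "J\<^sub>0 = P_symbol \<sigma>\<^sub>0" "J\<^sub>1 = P_symbol \<nu>\<^sub>0"
    unfolding baxter_le_def by metis
  with le have "psize \<sigma>\<^sub>0 = psize \<sigma>" by (simp add: psize_eq_if_baxter_le)
  from baxter_le_shuffle_over[OF this \<pi>] le
  show "\<pi> \<in> {\<pi>. pair_over J\<^sub>0 J\<^sub>1 \<le>\<^sub>B P_symbol \<pi>}" by (simp add: J)
qed

text \<open>The product rule for \<open>H\<close> at the level of index sets.\<close>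

lemma down_set_pair_under:
  assumes "twin_pair J\<^sub>0"
  shows "{\<pi>. P_symbol \<pi> \<le>\<^sub>B pair_under J\<^sub>0 J\<^sub>1} =
    (\<Union>\<sigma> \<in> {\<sigma>. P_symbol \<sigma> \<le>\<^sub>B J\<^sub>0}. \<Union>\<nu> \<in> {\<nu>. P_symbol \<nu> \<le>\<^sub>B J\<^sub>1}. shifted_shuffles \<sigma> \<nu>)"
proof (intro equalityI subsetI)
  fix \<pi> assume "\<pi> \<in> {\<pi>. P_symbol \<pi> \<le>\<^sub>B pair_under J\<^sub>0 J\<^sub>1}"
  then have le: "P_symbol \<pi> \<le>\<^sub>B pair_under J\<^sub>0 J\<^sub>1" by simp
  then obtain \<tau> where \<tau>: "P_symbol \<tau> = pair_under J\<^sub>0 J\<^sub>1" by (auto simp: baxter_le_def)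
  then obtain \<sigma>\<^sub>0 \<nu>\<^sub>0 where J: "J\<^sub>0 = P_symbol \<sigma>\<^sub>0" "J\<^sub>1 = P_symbol \<nu>\<^sub>0"
    using pair_under_factors[OF assms] by metis
  have "psize \<pi> = psize \<tau>" using le \<tau> psize_eq_if_baxter_le by metis
  moreover have "psize \<tau> = psize \<sigma>\<^sub>0 + psize \<nu>\<^sub>0"
    using size_P_symbol(1)[of \<tau>] \<tau> by (simp add: J pair_under_def size_tree_over size_P_symbol)
  ultimately have "psize \<sigma>\<^sub>0 \<le> psize \<pi>" by simp
  then obtain \<sigma> \<nu> where \<sigma>: "psize \<sigma> = psize \<sigma>\<^sub>0" "\<pi> \<in> shifted_shuffles \<sigma> \<nu>" by (rule unshuffle)
  with le show "\<pi> \<in> (\<Union>\<sigma> \<in> {\<sigma>. P_symbol \<sigma> \<le>\<^sub>B J\<^sub>0}. \<Union>\<nu> \<in> {\<nu>. P_symbol \<nu> \<le>\<^sub>B J\<^sub>1}. shifted_shuffles \<sigma> \<nu>)"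
    using baxter_le_shuffle_under[OF \<sigma>(1)[symmetric] \<sigma>(2)] unfolding J by blast
next
  fix \<pi> assume "\<pi> \<in> (\<Union>\<sigma> \<in> {\<sigma>. P_symbol \<sigma> \<le>\<^sub>B J\<^sub>0}. \<Union>\<nu> \<in> {\<nu>. P_symbol \<nu> \<le>\<^sub>B J\<^sub>1}. shifted_shuffles \<sigma> \<nu>)"
  then obtain \<sigma> \<nu> where le: "P_symbol \<sigma> \<le>\<^sub>B J\<^sub>0" "P_symbol \<nu> \<le>\<^sub>B J\<^sub>1"
    and \<pi>: "\<pi> \<in> shifted_shuffles \<sigma> \<nu>" by blast
  then obtain \<sigma>\<^sub>0 \<nu>\<^sub>0 where J: "J\<^sub>0 = P_symbol \<sigma>\<^sub>0" "J\<^sub>1 = P_symbol \<nu>\<^sub>0"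
    unfolding baxter_le_def by metis
  with le have "psize \<sigma>\<^sub>0 = psize \<sigma>" by (simp add: psize_eq_if_baxter_le)
  from baxter_le_shuffle_under[OF this \<pi>] le
  show "\<pi> \<in> {\<pi>. P_symbol \<pi> \<le>\<^sub>B pair_under J\<^sub>0 J\<^sub>1}" by (simp add: J)
qed

section \<open>Products of sums over up-sets and down-sets\<close>

text \<open>The fibres of \<open>P_symbol\<close> are disjoint, and since every value of
  \<open>P_symbol\<close> is a twin pair they cover all permutations on the right.\<close>

lemma sum_P_eq_sum_F:
  assumes "finite {J. twin_pair J \<and> R J}"
  shows "(\<Sum>J | twin_pair J \<and> R J. P J) =
    (\<Sum>\<sigma> | R (P_symbol \<sigma>). F \<sigma> :: 'k::{zero_neq_one,comm_monoid_add} fqsym)"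
proof -
  have "(\<Sum>\<sigma> \<in> (\<Union>J \<in> {J. twin_pair J \<and> R J}. {\<sigma>. P_symbol \<sigma> = J}). F \<sigma> :: 'k fqsym) =
      (\<Sum>J | twin_pair J \<and> R J. P J)"
    unfolding P_def using assms by (intro sum.UNION_disjoint) (auto simp: finite_P_symbol_fibre)
  moreover have "(\<Union>J \<in> {J. twin_pair J \<and> R J}. {\<sigma>. P_symbol \<sigma> = J}) = {\<sigma>. R (P_symbol \<sigma>)}"
    using twin_pair_P_symbol by auto
  ultimately show ?thesis by simp
qed

lemma lookup_sum_F:
  "finite A \<Longrightarrow> Poly_Mapping.lookup (\<Sum>\<sigma> \<in> A. F \<sigma> :: 'k::semiring_1 fqsym) \<tau> = (if \<tau> \<in> A then 1 else 0)"
  by (simp add: lookup_sum F_def lookup_single when_def)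

text \<open>The common size \<open>k\<close> on \<open>A\<close> is the threshold that recovers
  \<sigma>, and then \<nu>, from a shuffle. So no permutation is produced twice, and the union
  carries no multiplicities.\<close>

lemma sum_F_mult_sum_F:
  assumes "finite A" "finite B" "\<And>\<sigma>. \<sigma> \<in> A \<Longrightarrow> psize \<sigma> = k"
  shows "(\<Sum>\<sigma> \<in> A. F \<sigma>) \<bullet> (\<Sum>\<nu> \<in> B. F \<nu>) =
    (\<Sum>\<pi> \<in> (\<Union>\<sigma> \<in> A. \<Union>\<nu> \<in> B. shifted_shuffles \<sigma> \<nu>). F \<pi> :: 'k::semiring_1 fqsym)"
proof -
  have keys: "Poly_Mapping.keys (\<Sum>\<sigma> \<in> C. F \<sigma> :: 'k fqsym) = C" if "finite C" for C
    using that by (auto simp: in_keys_iff lookup_sum_F split: if_splits)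
  have "(\<Sum>\<sigma> \<in> A. F \<sigma> :: 'k fqsym) \<bullet> (\<Sum>\<nu> \<in> B. F \<nu>) =
      (\<Sum>\<sigma> \<in> A. \<Sum>\<nu> \<in> B. \<Sum>\<pi> \<in> shifted_shuffles \<sigma> \<nu>. F \<pi>)"
    unfolding fqsym_mult_def keys[OF assms(1)] keys[OF assms(2)]
    by (intro sum.cong refl) (simp add: lookup_sum_F assms(1,2), simp add: F_def)
  also have "\<dots> = (\<Sum>\<sigma> \<in> A. \<Sum>\<pi> \<in> (\<Union>\<nu> \<in> B. shifted_shuffles \<sigma> \<nu>). F \<pi>)"
  proof (rule sum.cong[OF refl], rule sum.UNION_disjoint[symmetric])
    fix \<sigma>
    have "inj (map (\<lambda>x. x + psize \<sigma>))" by (simp add: inj_def)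
    then show "\<forall>\<nu> \<in> B. \<forall>\<nu>' \<in> B. \<nu> \<noteq> \<nu>' \<longrightarrow> shifted_shuffles \<sigma> \<nu> \<inter> shifted_shuffles \<sigma> \<nu>' = {}"
      by (auto simp: in_shifted_shuffles_iff inj_eq letters_inject)
  qed (simp_all add: assms finite_shifted_shuffles)
  also have "\<dots> = (\<Sum>\<pi> \<in> (\<Union>\<sigma> \<in> A. \<Union>\<nu> \<in> B. shifted_shuffles \<sigma> \<nu>). F \<pi>)"
  proof (rule sum.UNION_disjoint[symmetric])
    show "\<forall>\<sigma> \<in> A. \<forall>\<sigma>' \<in> A. \<sigma> \<noteq> \<sigma>' \<longrightarrow>
        (\<Union>\<nu> \<in> B. shifted_shuffles \<sigma> \<nu>) \<inter> (\<Union>\<nu> \<in> B. shifted_shuffles \<sigma>' \<nu>) = {}"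
    proof (intro ballI impI)
      fix \<sigma> \<sigma>' assume \<sigma>: "\<sigma> \<in> A" "\<sigma>' \<in> A" "\<sigma> \<noteq> \<sigma>'"
      then have "psize \<sigma> = psize \<sigma>'" by (simp add: assms(3))
      moreover have "letters \<sigma> \<noteq> letters \<sigma>'" using \<sigma>(3) by (simp add: letters_inject)
      ultimately show "(\<Union>\<nu> \<in> B. shifted_shuffles \<sigma> \<nu>) \<inter> (\<Union>\<nu> \<in> B. shifted_shuffles \<sigma>' \<nu>) = {}"
        by (auto simp: in_shifted_shuffles_iff)
    qed
  qed (simp_all add: assms finite_shifted_shuffles)
  finally show ?thesis .
qed

lemma baxter_le_size: "J \<le>\<^sub>B J' \<Longrightarrow> size (fst J) = size (fst J')"
  unfolding baxter_le_def using psize_perm_le size_P_symbol(1) by metis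

theorem corollary6p9:
  fixes J\<^sub>0 J\<^sub>1 :: btree_pair
  assumes "twin_pair J\<^sub>0" and "twin_pair J\<^sub>1"
  shows "(E J\<^sub>0 \<bullet> E J\<^sub>1 :: 'k::field_char_0 fqsym) = E (pair_over J\<^sub>0 J\<^sub>1)
       \<and> (H J\<^sub>0 \<bullet> H J\<^sub>1 :: 'k fqsym) = H (pair_under J\<^sub>0 J\<^sub>1)"
proof
  have E: "E J = (\<Sum>\<sigma> | J \<le>\<^sub>B P_symbol \<sigma>. F \<sigma> :: 'k fqsym)" for J
    unfolding E_def by (rule sum_P_eq_sum_F) (rule finite_baxter_up)
  have H: "H J = (\<Sum>\<sigma> | P_symbol \<sigma> \<le>\<^sub>B J. F \<sigma> :: 'k fqsym)" for J
    unfolding H_def by (rule sum_P_eq_sum_F) (rule finite_baxter_down)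
  \<comment> \<open>All permutations comparable with \<open>J\<close> have its size; this makes the
    index sets finite and supplies the common threshold for the products.\<close>
  have up: "J \<le>\<^sub>B P_symbol \<sigma> \<Longrightarrow> psize \<sigma> = size (fst J)"
    and down: "P_symbol \<sigma> \<le>\<^sub>B J \<Longrightarrow> psize \<sigma> = size (fst J)" for J \<sigma>
    using baxter_le_size size_P_symbol(1) by metis+
  have finite: "finite {\<sigma>. J \<le>\<^sub>B P_symbol \<sigma>}" "finite {\<sigma>. P_symbol \<sigma> \<le>\<^sub>B J}" for J
    by (rule finite_subset[OF _ finite_psize[of "size (fst J)"]], use up down in blast)+
  show "(E J\<^sub>0 \<bullet> E J\<^sub>1 :: 'k fqsym) = E (pair_over J\<^sub>0 J\<^sub>1)"
    unfolding E up_set_pair_over[OF assms(1)]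
    by (rule sum_F_mult_sum_F[OF finite(1) finite(1)]) (use up in blast)
  show "(H J\<^sub>0 \<bullet> H J\<^sub>1 :: 'k fqsym) = H (pair_under J\<^sub>0 J\<^sub>1)"
    unfolding H down_set_pair_under[OF assms(1)]
    by (rule sum_F_mult_sum_F[OF finite(2) finite(2)]) (use down in blast)
qed

end
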